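(* Consider either the Euler--Maruyama BUG integrator ($\theta=\mathrm{EM}$) or the stochastic Heun BUG integrator ($\theta=\mathrm{Heun}$) with basis augmentation and conservative truncation, as defined in the context, for the stochastic Vlasov--Poisson equation. Assume that the fixed velocity space contains the constant mode ($m\ge 1$, $U_1=1/\|1\|_v$) and that the projection identities $$\sum_i \langle \widetilde X_i^{n+1},X_j^n\rangle_x\,\widetilde X_i^{n+1}=X_j^n,\qquad \sum_k\langle V_l^n,\widetilde V_k^{n+1}\rangle_v\,\widetilde V_k^{n+1}=V_l^n\qquad (1\le j,l\le r)$$ hold at every step. Then, for both integrators and for all $n=0,\dots,N-1$, almost surely, $$\frac{\rho^{n+1}-\rho^n}{\tau}+\nabla_x\cdot J^n=0,$$ where $\rho^n(x)=\int_{\mathbb R^d}f^n(x,v)\,dv$ and $J^n(x)=\int_{\mathbb R^d}v\,f^n(x,v)\,dv$. In particular the total mass is conserved: $\mathcal M[f^n]=\mathcal M[f^0]$ for all $0\le n\le N$, where $\mathcal M[f^n]=\int_{\mathbb T^d}\rho^n(x)\,dx$.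
   Context: Model. $x\in\mathbb T^d$, $v\in\mathbb R^d$; $\beta_1,\dots,\beta_K$ are independent Brownian motions on a complete filtered probability space $(\Omega,\mathcal F,\{\mathcal F_t\},\mathbb P)$; $\sigma_s:\mathbb T^d\to\mathbb R^d$ are given and $\sigma=(\sigma_1,\dots,\sigma_K)$ is the $d\times K$ matrix with these columns. The stochastic Vlasov--Poisson equation in Stratonovich form is $df+(v\cdot\nabla_xf+E\cdot\nabla_vf)\,dt+\sum_{s}\sigma_s(x)\cdot\nabla_vf\star d\beta_s=0$, with $E=-\nabla u$, $-\Delta u=\int f\,dv-1$. Time step $\tau>0$, $t_n=n\tau$, $0\le n\le N$, $\Delta\beta_n^s=\beta_s(t_{n+1})-\beta_s(t_n)$. Inner products. $f_{0v}(v)>0$ is a fixed weight (e.g. Gaussian) such that $1$, $v_i$, $|v|^2$ belong to $L^2(\mathbb R^d;f_{0v})$. $\langle g,h\rangle_x=\int gh\,dx$; $\langle g,h\rangle_v=\int f_{0v}gh\,dv$ with norm $\|\cdot\|_v$; $(\cdot,\cdot)_v$ and $(\cdot,\cdot)_{xv}$ are the unweighted $L^2$ products in $v$ and $(x,v)$. Calculus conventions. In the fully discrete scheme integrals and derivatives in $x$ and $v$ are discretized (centered differences) so as to retain: linearity; $\int\partial_{x_l}u\,dx=0$ (periodicity); integration by parts in $v$ without boundary terms, in particular $\int\partial_{v_l}g\,dv=0$ for the functions $g$ that occur; functions of $x$ commute with $\partial_v$. Continuous notation is used throughout; the exact integrals and derivatives (with enough regularity and velocity decay) also satisfy these rules.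 Low-rank state. $f^n=f_{0v}\sum_{i,j=1}^rX_i^nS_{ij}^nV_j^n$ with $(X_i^n)$ orthonormal for $\langle\cdot,\cdot\rangle_x$, $(V_j^n)$ orthonormal for $\langle\cdot,\cdot\rangle_v$; $V_a^n=U_a$ is a fixed, time-independent mode for $a\le m$, and $V_p^n=W_p^n$ for $m<p\le r$. $E^n$ is the electric field obtained from $f^n$ by the Poisson equation. Increments. $\mathcal D(f^n)=-v\cdot\nabla_xf^n-E^n\cdot\nabla_vf^n$; $\mathcal S_{\mathrm{EM}}(f)=-\sum_s\sigma_s\cdot\nabla_vf\,\Delta\beta_n^s+\frac{\tau}{2}\nabla_v\cdot(\sigma\sigma^\top\nabla_vf)$; $\mathcal S_{\mathrm{Heun}}(f)=-\frac12\sum_s(\sigma_s\cdot\nabla_vf+\sigma_s\cdot\nabla_v\widetilde f)\Delta\beta_n^s$ with $\widetilde f=f-\sum_s\sigma_s\cdot\nabla_vf\,\Delta\beta_n^s$. One step of the BUG integrator of type $\theta\in\{\mathrm{EM},\mathrm{Heun}\}$: (1) K-step: with $K_k^n=\sum_iX_i^nS_{ik}^n$, set $K_k^{n+1}=K_k^n+\tau(V_k^n,\mathcal D(f^n))_v+(V_k^n,\mathcal S_\theta(f^n))_v$, $1\le k\le r$. (2) L-step: with $L_q^n=\sum_{ip}S_{iq}^nS_{ip}^nW_p^n$, for $m<q\le r$ set $L_q^{n+1}=L_q^n+\frac1{f_{0v}}\sum_iS_{iq}^n\langle X_i^n,\tau\mathcal D(f^n)+\mathcal S_\theta(f^n)\rangle_x-\sum_{il}S_{iq}^n(X_i^nV_l^n,\tau\mathcal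 D(f^n)+\mathcal S_\theta(f^n))_{xv}V_l^n$. (3) Augmentation: $(\widetilde X_k^{n+1})_k$ is an orthonormal basis of a space containing $\mathrm{span}\{X_i^n,\partial_{x_l}X_i^n,K_i^{n+1}\}$ (equal to it for the standard augmentation); $(\widetilde V_l^{n+1})_l$ is an orthonormal basis of $\mathrm{span}\{U_a,W_p^n,L_p^{n+1}\}$ whose first $m$ elements are $U_1,\dots,U_m$. Consequently the orthogonal projection onto $\mathrm{span}\{\widetilde X_k^{n+1}\}$ fixes each $X_j^n$ and each $\partial_{x_l}X_j^n$. (4) S-step: with $M_{ki}=\langle\widetilde X_k^{n+1},X_i^n\rangle_x$, $N^\top_{jl}=\langle V_j^n,\widetilde V_l^{n+1}\rangle_v$ and $f_{aug}^{n+1}=f_{0v}\sum_{kijl}\widetilde X_k^{n+1}M_{ki}S_{ij}^nN^\top_{jl}\widetilde V_l^{n+1}$, set $\widetilde S_{kl}^{n+1}=\sum_{ij}M_{ki}S_{ij}^nN^\top_{jl}+\tau(\widetilde X_k^{n+1}\widetilde V_l^{n+1},\mathcal D(f_{aug}^{n+1}))_{xv}+(\widetilde X_k^{n+1}\widetilde V_l^{n+1},\mathcal S_\theta(f_{aug}^{n+1}))_{xv}$ (the electric field in $\mathcal D(f_{aug}^{n+1})$ is the one associated with $f_{aug}^{n+1}$). (5) Conservative truncation: let $\widetilde K_l=\sum_k\widetilde X_k^{n+1}\widetilde S_{kl}^{n+1}$. The columns $\widetilde K_1,\dots,\widetilde K_m$ (coefficients of $U_1,\dots,U_m$) are kept exactly,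 with QR factorization $\widetilde K^{cons}=X^{cons}S^{cons}$. The remaining columns are factored as $\widetilde K^{rem}=\widetilde X^{rem}\widetilde S^{rem}$ (QR), and $\widetilde S^{rem}\approx\hat U\hat S\hat W^\top$ is the SVD truncated to the $r-m$ largest singular values; $X^{rem}=\widetilde X^{rem}\hat U$, $S^{rem}=\hat S$, $W^{n+1}=(\widetilde V^{n+1}_l)_{l>m}\hat W$, $V^{n+1}=[U\ W^{n+1}]$. Finally $[X^{cons}\ X^{rem}]=X^{n+1}R$ (QR) and $S^{n+1}=R\,\mathrm{diag}(S^{cons},S^{rem})$, so that $f^{n+1}=f_{0v}\sum_{ij}X_i^{n+1}S_{ij}^{n+1}V_j^{n+1}$. *)

theory Defs
  imports "HOL-Probability.Probability"
begin

section \<open>Calculus in position and velocity\<close>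

text \<open>
  The scheme is used both with exact integrals and derivatives and with discretized ones, and
  only a few calculus rules are shared by all these readings. A \<open>calculus\<close> therefore consists of
  points \<open>'x\<close> of the torus (or of a periodic grid), points \<open>'v\<close> of velocity space (or of a
  velocity grid), the measures that integrate over them, the velocity coordinates of a point of
  \<open>'v\<close>, and the partial derivatives. The last three components are regularity classes: \<open>posC\<close>
  consists of the functions of position that may be multiplied and integrated, \<open>posD\<close> and
  \<open>velD\<close> of the functions that may be differentiated. Two calculi, the exact one on
  \<open>T^d \<times> R^d\<close> and centered differences on grids, are given at the end of this theory.
\<close>

record ('x, 'v, 'd) calculus =
  posM :: "'x measure"
  velM :: "'v measure"
  vel  :: "'v \<Rightarrow> real ^ 'd"
  dX   :: "'d \<Rightarrow> ('x \<Rightarrow> real) \<Rightarrow> 'x \<Rightarrow> real"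
  dV   :: "'d \<Rightarrow> ('v \<Rightarrow> real) \<Rightarrow> 'v \<Rightarrow> real"
  posC :: "('x \<Rightarrow> real) set"
  posD :: "('x \<Rightarrow> real) set"
  velD :: "('v \<Rightarrow> real) set"

definition fun_subspace :: "('a \<Rightarrow> real) set \<Rightarrow> bool" where
  "fun_subspace A \<longleftrightarrow> (\<lambda>_. 0) \<in> A \<and>
     (\<forall>g\<in>A. \<forall>h\<in>A. \<forall>a b. (\<lambda>y. a * g y + b * h y) \<in> A)"

definition linear_op_on ::
    "('a \<Rightarrow> real) set \<Rightarrow> (('a \<Rightarrow> real) \<Rightarrow> 'a \<Rightarrow> real) \<Rightarrow> bool" where
  "linear_op_on A T \<longleftrightarrow>
     (\<forall>g\<in>A. \<forall>h\<in>A. \<forall>a b. T (\<lambda>y. a * g y + b * h y) = (\<lambda>y. a * T g y + b * T h y))"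

text \<open>
  No product rule is assumed, since centered differences do not satisfy one. That functions of
  position commute with velocity derivatives (and vice versa) is built in, because the
  derivatives of a function of \<open>(x, v)\<close> are taken slicewise, see \<open>gradX2\<close> and \<open>gradV\<close> below.
\<close>

locale calculus_rules =
  fixes c :: "('x, 'v, 'd::finite) calculus"
  assumes sigma_finite_posM: "sigma_finite_measure (posM c)"
    and sigma_finite_velM: "sigma_finite_measure (velM c)"
    and posC_subspace: "fun_subspace (posC c)"
    and posC_const: "(\<lambda>_. 1) \<in> posC c"
    and posC_mult: "\<And>g h. g \<in> posC c \<Longrightarrow> h \<in> posC c \<Longrightarrow> (\<lambda>x. g x * h x) \<in> posC c"
    and posC_integrable: "\<And>g. g \<in> posC c \<Longrightarrow> integrable (posM c) g"
    and posD_subspace: "fun_subspace (posD c)"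
    and posD_posC: "posD c \<subseteq> posC c"
    and dX_linear: "\<And>l. linear_op_on (posD c) (dX c l)"
    and dX_posC: "\<And>l u. u \<in> posD c \<Longrightarrow> dX c l u \<in> posC c"
    and integral_dX: "\<And>l u. u \<in> posD c \<Longrightarrow> (\<integral>x. dX c l u x \<partial>posM c) = 0"
    and velD_subspace: "fun_subspace (velD c)"
    and dV_linear: "\<And>l. linear_op_on (velD c) (dV c l)"
    and dV_integrable: "\<And>l g. g \<in> velD c \<Longrightarrow> integrable (velM c) (dV c l g)"
    and integral_dV: "\<And>l g. g \<in> velD c \<Longrightarrow> (\<integral>v. dV c l g v \<partial>velM c) = 0"

definition gradX :: "('x, 'v, 'd::finite) calculus \<Rightarrow> ('x \<Rightarrow> real) \<Rightarrow> 'x \<Rightarrow> real ^ 'd" where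
  "gradX c u x = (\<chi> l. dX c l u x)"

definition divX :: "('x, 'v, 'd::finite) calculus \<Rightarrow> ('x \<Rightarrow> real ^ 'd) \<Rightarrow> 'x \<Rightarrow> real" where
  "divX c G x = (\<Sum>l\<in>UNIV. dX c l (\<lambda>y. G y $ l) x)"

definition gradX2 ::
    "('x, 'v, 'd::finite) calculus \<Rightarrow> ('x \<Rightarrow> 'v \<Rightarrow> real) \<Rightarrow> 'x \<Rightarrow> 'v \<Rightarrow> real ^ 'd" where
  "gradX2 c f x v = gradX c (\<lambda>y. f y v) x"

definition gradV ::
    "('x, 'v, 'd::finite) calculus \<Rightarrow> ('x \<Rightarrow> 'v \<Rightarrow> real) \<Rightarrow> 'x \<Rightarrow> 'v \<Rightarrow> real ^ 'd" where
  "gradV c f x v = (\<chi> l. dV c l (f x) v)"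

definition divV ::
    "('x, 'v, 'd::finite) calculus \<Rightarrow> ('x \<Rightarrow> 'v \<Rightarrow> real ^ 'd) \<Rightarrow> 'x \<Rightarrow> 'v \<Rightarrow> real" where
  "divV c G x v = (\<Sum>l\<in>UNIV. dV c l (\<lambda>w. G x w $ l) v)"

definition innerX :: "('x, 'v, 'd::finite) calculus \<Rightarrow> ('x \<Rightarrow> real) \<Rightarrow> ('x \<Rightarrow> real) \<Rightarrow> real" where
  "innerX c g h = (\<integral>x. g x * h x \<partial>posM c)"

text \<open>The product \<open>\<langle>g, h\<rangle>\<close> with weight \<open>w\<close>, which is \<open>f_0v\<close> throughout.\<close>

definition innerW ::
    "('x, 'v, 'd::finite) calculus \<Rightarrow> ('v \<Rightarrow> real) \<Rightarrow> ('v \<Rightarrow> real) \<Rightarrow> ('v \<Rightarrow> real) \<Rightarrow> real" where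
  "innerW c w g h = (\<integral>v. w v * g v * h v \<partial>velM c)"

definition normW :: "('x, 'v, 'd::finite) calculus \<Rightarrow> ('v \<Rightarrow> real) \<Rightarrow> ('v \<Rightarrow> real) \<Rightarrow> real" where
  "normW c w g = sqrt (innerW c w g g)"

definition innerV :: "('x, 'v, 'd::finite) calculus \<Rightarrow> ('v \<Rightarrow> real) \<Rightarrow> ('v \<Rightarrow> real) \<Rightarrow> real" where
  "innerV c g h = (\<integral>v. g v * h v \<partial>velM c)"

definition innerXV ::
    "('x, 'v, 'd::finite) calculus \<Rightarrow> ('x \<Rightarrow> 'v \<Rightarrow> real) \<Rightarrow> ('x \<Rightarrow> 'v \<Rightarrow> real) \<Rightarrow> real" where
  "innerXV c g h = (\<integral>z. g (fst z) (snd z) * h (fst z) (snd z) \<partial>(posM c \<Otimes>\<^sub>M velM c))"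

definition L2W :: "('x, 'v, 'd::finite) calculus \<Rightarrow> ('v \<Rightarrow> real) \<Rightarrow> ('v \<Rightarrow> real) set" where
  "L2W c w = {g. g \<in> borel_measurable (velM c) \<and> integrable (velM c) (\<lambda>v. w v * (g v)\<^sup>2)}"

definition velocity_weight :: "('x, 'v, 'd::finite) calculus \<Rightarrow> ('v \<Rightarrow> real) \<Rightarrow> bool" where
  "velocity_weight c w \<longleftrightarrow> w \<in> borel_measurable (velM c) \<and> (\<forall>v. 0 < w v) \<and>
     (\<lambda>_. 1) \<in> L2W c w \<and> (\<forall>l. (\<lambda>v. vel c v $ l) \<in> L2W c w) \<and>
     (\<lambda>v. (norm (vel c v))\<^sup>2) \<in> L2W c w"

text \<open>Families of modes are indexed by \<open>{1..n}\<close>; values at other indices are irrelevant.\<close>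

definition orthonormalX :: "('x, 'v, 'd::finite) calculus \<Rightarrow> nat \<Rightarrow> (nat \<Rightarrow> 'x \<Rightarrow> real) \<Rightarrow> bool" where
  "orthonormalX c n B \<longleftrightarrow> (\<forall>i\<in>{1..n}. B i \<in> posC c) \<and>
     (\<forall>i\<in>{1..n}. \<forall>j\<in>{1..n}. innerX c (B i) (B j) = (if i = j then 1 else 0))"

definition orthonormalW ::
    "('x, 'v, 'd::finite) calculus \<Rightarrow> ('v \<Rightarrow> real) \<Rightarrow> nat \<Rightarrow> (nat \<Rightarrow> 'v \<Rightarrow> real) \<Rightarrow> bool" where
  "orthonormalW c w n B \<longleftrightarrow> (\<forall>i\<in>{1..n}. B i \<in> L2W c w) \<and>
     (\<forall>i\<in>{1..n}. \<forall>j\<in>{1..n}. innerW c w (B i) (B j) = (if i = j then 1 else 0))"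

definition in_span :: "nat \<Rightarrow> (nat \<Rightarrow> 'a \<Rightarrow> real) \<Rightarrow> ('a \<Rightarrow> real) \<Rightarrow> bool" where
  "in_span n B g \<longleftrightarrow> (\<exists>a. g = (\<lambda>y. \<Sum>k=1..n. a k * B k y))"


section \<open>Brownian motions\<close>

definition complete_filtered_prob_space :: "'w measure \<Rightarrow> (real \<Rightarrow> 'w measure) \<Rightarrow> bool" where
  "complete_filtered_prob_space P F \<longleftrightarrow> prob_space P \<and> complete_measure P \<and>
     (\<forall>t\<ge>0. subalgebra P (F t)) \<and>
     (\<forall>s\<ge>0. \<forall>t\<ge>s. subalgebra (F t) (F s)) \<and>
     null_sets P \<subseteq> sets (F 0)"

definition brownian_motion ::
    "'w measure \<Rightarrow> (real \<Rightarrow> 'w measure) \<Rightarrow> (real \<Rightarrow> 'w \<Rightarrow> real) \<Rightarrow> bool" where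
  "brownian_motion P F B \<longleftrightarrow>
     (\<forall>t\<ge>0. B t \<in> borel_measurable (F t)) \<and>
     (AE \<omega> in P. B 0 \<omega> = 0) \<and>
     (AE \<omega> in P. continuous_on {0..} (\<lambda>t. B t \<omega>)) \<and>
     (\<forall>s\<ge>0. \<forall>t>s.
        distributed P lborel (\<lambda>\<omega>. B t \<omega> - B s \<omega>) (normal_density 0 (sqrt (t - s))) \<and>
        prob_space.indep_set P
          (sets (vimage_algebra (space P) (\<lambda>\<omega>. B t \<omega> - B s \<omega>) borel)) (sets (F s)))"

definition independent_brownian_motions ::
    "'w measure \<Rightarrow> (real \<Rightarrow> 'w measure) \<Rightarrow> ('k \<Rightarrow> real \<Rightarrow> 'w \<Rightarrow> real) \<Rightarrow> bool" where
  "independent_brownian_motions P F \<beta> \<longleftrightarrow>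
     (\<forall>s. brownian_motion P F (\<beta> s)) \<and>
     prob_space.indep_sets P
       (\<lambda>s. sigma_sets (space P) {\<beta> s t -` A \<inter> space P | t A. 0 \<le> t \<and> A \<in> sets borel}) UNIV"

definition brownian_increment ::
    "('k \<Rightarrow> real \<Rightarrow> 'w \<Rightarrow> real) \<Rightarrow> real \<Rightarrow> nat \<Rightarrow> 'w \<Rightarrow> 'k \<Rightarrow> real" where
  "brownian_increment \<beta> \<tau> n \<omega> s = \<beta> s (real (n + 1) * \<tau>) \<omega> - \<beta> s (real n * \<tau>) \<omega>"


section \<open>Moments, electric field and increments\<close>

definition charge_density :: "('x, 'v, 'd::finite) calculus \<Rightarrow> ('x \<Rightarrow> 'v \<Rightarrow> real) \<Rightarrow> 'x \<Rightarrow> real" where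
  "charge_density c f x = (\<integral>v. f x v \<partial>velM c)"

definition current_density ::
    "('x, 'v, 'd::finite) calculus \<Rightarrow> ('x \<Rightarrow> 'v \<Rightarrow> real) \<Rightarrow> 'x \<Rightarrow> real ^ 'd" where
  "current_density c f x = (\<integral>v. f x v *\<^sub>R vel c v \<partial>velM c)"

definition total_mass :: "('x, 'v, 'd::finite) calculus \<Rightarrow> ('x \<Rightarrow> 'v \<Rightarrow> real) \<Rightarrow> real" where
  "total_mass c f = (\<integral>x. charge_density c f x \<partial>posM c)"

definition electric_field ::
    "('x, 'v, 'd::finite) calculus \<Rightarrow> ('x \<Rightarrow> 'v \<Rightarrow> real) \<Rightarrow> ('x \<Rightarrow> real ^ 'd) \<Rightarrow> bool" where
  "electric_field c f E \<longleftrightarrow>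
     (\<exists>u. u \<in> posD c \<and> (\<forall>l. dX c l u \<in> posD c) \<and>
        (\<forall>x. E x = - gradX c u x) \<and>
        (\<forall>x. - divX c (gradX c u) x = charge_density c f x - 1))"

definition drift_incr ::
    "('x, 'v, 'd::finite) calculus \<Rightarrow> ('x \<Rightarrow> real ^ 'd) \<Rightarrow> ('x \<Rightarrow> 'v \<Rightarrow> real) \<Rightarrow> 'x \<Rightarrow> 'v \<Rightarrow> real"
  where
  "drift_incr c E f x v = - (vel c v \<bullet> gradX2 c f x v) - E x \<bullet> gradV c f x v"

text \<open>The columns of the matrix \<open>\<sigma> x\<close> are the vectors \<open>\<sigma>\<^sub>s(x)\<close>.\<close>

definition noise_incr ::
    "('x, 'v, 'd::finite) calculus \<Rightarrow> ('x \<Rightarrow> real ^ 'k::finite ^ 'd) \<Rightarrow> ('k \<Rightarrow> real) \<Rightarrow>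
     ('x \<Rightarrow> 'v \<Rightarrow> real) \<Rightarrow> 'x \<Rightarrow> 'v \<Rightarrow> real" where
  "noise_incr c \<sigma> \<Delta> f x v = (\<Sum>s\<in>UNIV. (column s (\<sigma> x) \<bullet> gradV c f x v) * \<Delta> s)"

datatype integrator = EM | Heun

fun stoch_incr ::
    "integrator \<Rightarrow> ('x, 'v, 'd::finite) calculus \<Rightarrow> ('x \<Rightarrow> real ^ 'k::finite ^ 'd) \<Rightarrow> real \<Rightarrow>
     ('k \<Rightarrow> real) \<Rightarrow> ('x \<Rightarrow> 'v \<Rightarrow> real) \<Rightarrow> 'x \<Rightarrow> 'v \<Rightarrow> real" where
  "stoch_incr EM c \<sigma> \<tau> \<Delta> f x v =
     - noise_incr c \<sigma> \<Delta> f x v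
     + \<tau> / 2 * divV c (\<lambda>y w. (\<sigma> y ** transpose (\<sigma> y)) *v gradV c f y w) x v"
| "stoch_incr Heun c \<sigma> \<tau> \<Delta> f x v =
     (let ft = (\<lambda>y w. f y w - noise_incr c \<sigma> \<Delta> f y w)
      in - (1 / 2) * (\<Sum>s\<in>UNIV. (column s (\<sigma> x) \<bullet> gradV c f x v
                              + column s (\<sigma> x) \<bullet> gradV c ft x v) * \<Delta> s))"


section \<open>Low-rank states\<close>

record ('x, 'v) lowrank =
  mX :: "nat \<Rightarrow> 'x \<Rightarrow> real"
  mS :: "nat \<Rightarrow> nat \<Rightarrow> real"
  mV :: "nat \<Rightarrow> 'v \<Rightarrow> real"

definition lr_density :: "('v \<Rightarrow> real) \<Rightarrow> nat \<Rightarrow> ('x, 'v) lowrank \<Rightarrow> 'x \<Rightarrow> 'v \<Rightarrow> real" where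
  "lr_density w r z x v = w v * (\<Sum>i=1..r. \<Sum>j=1..r. mX z i x * mS z i j * mV z j v)"

definition lowrank_state ::
    "('x, 'v, 'd::finite) calculus \<Rightarrow> ('v \<Rightarrow> real) \<Rightarrow> nat \<Rightarrow> nat \<Rightarrow> (nat \<Rightarrow> 'v \<Rightarrow> real) \<Rightarrow>
     ('x, 'v) lowrank \<Rightarrow> bool" where
  "lowrank_state c w m r U z \<longleftrightarrow>
     orthonormalX c r (mX z) \<and> orthonormalW c w r (mV z) \<and> (\<forall>a\<in>{1..m}. mV z a = U a)"

text \<open>
  Regularity and velocity decay of a state: the derivatives that occur in the increments exist
  (at most one in \<open>x\<close>, at most two in \<open>v\<close>) and integrations by parts in \<open>v\<close> have no
  boundary terms.
\<close>

definition regular_state ::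
    "('x, 'v, 'd::finite) calculus \<Rightarrow> ('v \<Rightarrow> real) \<Rightarrow> nat \<Rightarrow> ('x, 'v) lowrank \<Rightarrow> bool" where
  "regular_state c w r z \<longleftrightarrow>
     (\<forall>i\<in>{1..r}. mX z i \<in> posD c) \<and>
     (\<forall>j\<in>{1..r}. (\<lambda>v. w v * mV z j v) \<in> velD c \<and>
        (\<forall>l. dV c l (\<lambda>v. w v * mV z j v) \<in> velD c))"


section \<open>One step of the BUG integrator\<close>

text \<open>
  The arguments \<open>D\<close> and \<open>G\<close> are the drift and stochastic increments of the current state,
  functions of \<open>(x, v)\<close>.
\<close>

definition K_next ::
    "('x, 'v, 'd::finite) calculus \<Rightarrow> nat \<Rightarrow> real \<Rightarrow> ('x \<Rightarrow> 'v \<Rightarrow> real) \<Rightarrow>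
     ('x \<Rightarrow> 'v \<Rightarrow> real) \<Rightarrow> ('x, 'v) lowrank \<Rightarrow> nat \<Rightarrow> 'x \<Rightarrow> real"
  where
  "K_next c r \<tau> D G z k x =
     (\<Sum>i=1..r. mX z i x * mS z i k) + \<tau> * innerV c (mV z k) (D x) + innerV c (mV z k) (G x)"

definition L_next ::
    "('x, 'v, 'd::finite) calculus \<Rightarrow> ('v \<Rightarrow> real) \<Rightarrow> nat \<Rightarrow> nat \<Rightarrow> real \<Rightarrow> ('x \<Rightarrow> 'v \<Rightarrow> real) \<Rightarrow>
     ('x \<Rightarrow> 'v \<Rightarrow> real) \<Rightarrow> ('x, 'v) lowrank \<Rightarrow> nat \<Rightarrow> 'v \<Rightarrow> real" where
  "L_next c w m r \<tau> D G z q v =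
     (\<Sum>i=1..r. \<Sum>p=m+1..r. mS z i q * mS z i p * mV z p v)
     + 1 / w v * (\<Sum>i=1..r. mS z i q * innerX c (mX z i) (\<lambda>x. \<tau> * D x v + G x v))
     - (\<Sum>i=1..r. \<Sum>l=1..r. mS z i q *
          innerXV c (\<lambda>x v. mX z i x * mV z l v) (\<lambda>x v. \<tau> * D x v + G x v) * mV z l v)"

record ('x, 'v) augmented =
  rX :: nat
  rV :: nat
  aX :: "nat \<Rightarrow> 'x \<Rightarrow> real"
  aV :: "nat \<Rightarrow> 'v \<Rightarrow> real"

text \<open>
  The position basis may span more than the required functions. The velocity basis spans
  exactly the old velocity modes \<open>1..r\<close> (fixed ones included) and \<open>L_next q\<close>, \<open>q = m+1..r\<close>.
\<close>

definition basis_augmentation ::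
    "('x, 'v, 'd::finite) calculus \<Rightarrow> ('v \<Rightarrow> real) \<Rightarrow> nat \<Rightarrow> nat \<Rightarrow> (nat \<Rightarrow> 'v \<Rightarrow> real) \<Rightarrow>
     real \<Rightarrow> ('x \<Rightarrow> 'v \<Rightarrow> real) \<Rightarrow> ('x \<Rightarrow> 'v \<Rightarrow> real) \<Rightarrow>
     ('x, 'v) lowrank \<Rightarrow> ('x, 'v) augmented \<Rightarrow> bool" where
  "basis_augmentation c w m r U \<tau> D G z A \<longleftrightarrow>
     orthonormalX c (rX A) (aX A) \<and>
     (\<forall>i\<in>{1..r}. in_span (rX A) (aX A) (mX z i) \<and>
        (\<forall>l. in_span (rX A) (aX A) (dX c l (mX z i))) \<and>
        in_span (rX A) (aX A) (K_next c r \<tau> D G z i)) \<and>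
     orthonormalW c w (rV A) (aV A) \<and>
     (\<forall>j\<in>{1..r}. in_span (rV A) (aV A) (mV z j)) \<and>
     (\<forall>q\<in>{m+1..r}. in_span (rV A) (aV A) (L_next c w m r \<tau> D G z q)) \<and>
     (\<forall>k\<in>{1..rV A}. \<exists>a b. aV A k =
        (\<lambda>v. (\<Sum>j=1..r. a j * mV z j v) + (\<Sum>q=m+1..r. b q * L_next c w m r \<tau> D G z q v))) \<and>
     m \<le> rV A \<and> (\<forall>a\<in>{1..m}. aV A a = U a)"

definition aug_core ::
    "('x, 'v, 'd::finite) calculus \<Rightarrow> ('v \<Rightarrow> real) \<Rightarrow> nat \<Rightarrow> ('x, 'v) lowrank \<Rightarrow> ('x, 'v) augmented \<Rightarrow>
     nat \<Rightarrow> nat \<Rightarrow> real" where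
  "aug_core c w r z A k l =
     (\<Sum>i=1..r. \<Sum>j=1..r. innerX c (aX A k) (mX z i) * mS z i j * innerW c w (mV z j) (aV A l))"

definition aug_density ::
    "('x, 'v, 'd::finite) calculus \<Rightarrow> ('v \<Rightarrow> real) \<Rightarrow> nat \<Rightarrow> ('x, 'v) lowrank \<Rightarrow> ('x, 'v) augmented \<Rightarrow>
     'x \<Rightarrow> 'v \<Rightarrow> real" where
  "aug_density c w r z A x v =
     w v * (\<Sum>k=1..rX A. \<Sum>l=1..rV A. aX A k x * aug_core c w r z A k l * aV A l v)"

text \<open>Here \<open>D\<close> and \<open>G\<close> are the increments of the augmented state \<open>aug_density\<close>.\<close>

definition S_next ::
    "('x, 'v, 'd::finite) calculus \<Rightarrow> ('v \<Rightarrow> real) \<Rightarrow> nat \<Rightarrow> real \<Rightarrow> ('x \<Rightarrow> 'v \<Rightarrow> real) \<Rightarrow>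
     ('x \<Rightarrow> 'v \<Rightarrow> real) \<Rightarrow> ('x, 'v) lowrank \<Rightarrow> ('x, 'v) augmented \<Rightarrow> nat \<Rightarrow> nat \<Rightarrow> real" where
  "S_next c w r \<tau> D G z A k l = aug_core c w r z A k l
     + \<tau> * innerXV c (\<lambda>x v. aX A k x * aV A l v) D
     + innerXV c (\<lambda>x v. aX A k x * aV A l v) G"

text \<open>Reduced QR factorization \<open>Y = Q R\<close> of \<open>n\<close> columns \<open>Y 1, \<dots>, Y n\<close> of functions.\<close>

definition qr_factorization ::
    "('x, 'v, 'd::finite) calculus \<Rightarrow> nat \<Rightarrow> (nat \<Rightarrow> 'x \<Rightarrow> real) \<Rightarrow> (nat \<Rightarrow> 'x \<Rightarrow> real) \<Rightarrow>
     (nat \<Rightarrow> nat \<Rightarrow> real) \<Rightarrow> bool" where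
  "qr_factorization c n Y Q R \<longleftrightarrow> orthonormalX c n Q \<and>
     (\<forall>k\<in>{1..n}. \<forall>l\<in>{1..n}. l < k \<longrightarrow> R k l = 0) \<and>
     (\<forall>l\<in>{1..n}. Y l = (\<lambda>x. \<Sum>k=1..n. Q k x * R k l))"

definition orthogonal_mat :: "nat \<Rightarrow> (nat \<Rightarrow> nat \<Rightarrow> real) \<Rightarrow> bool" where
  "orthogonal_mat n P \<longleftrightarrow>
     (\<forall>a\<in>{1..n}. \<forall>b\<in>{1..n}. (\<Sum>k=1..n. P k a * P k b) = (if a = b then 1 else 0))"

text \<open>
  Singular value decomposition of an \<open>n \<times> n\<close> matrix with decreasing singular values; the
  truncation to the \<open>k\<close> largest ones consists of the columns \<open>1..k\<close> of \<open>P\<close> and \<open>Q\<close> and of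
  \<open>s 1, \<dots>, s k\<close>.
\<close>

definition svd ::
    "nat \<Rightarrow> (nat \<Rightarrow> nat \<Rightarrow> real) \<Rightarrow> (nat \<Rightarrow> nat \<Rightarrow> real) \<Rightarrow> (nat \<Rightarrow> real) \<Rightarrow> (nat \<Rightarrow> nat \<Rightarrow> real) \<Rightarrow>
     bool" where
  "svd n T P s Q \<longleftrightarrow> orthogonal_mat n P \<and> orthogonal_mat n Q \<and>
     (\<forall>a\<in>{1..n}. 0 \<le> s a) \<and> (\<forall>a\<in>{1..n}. \<forall>b\<in>{1..n}. a \<le> b \<longrightarrow> s b \<le> s a) \<and>
     (\<forall>a\<in>{1..n}. \<forall>b\<in>{1..n}. T a b = (\<Sum>k=1..n. P a k * s k * Q b k))"

text \<open>
  Conservative truncation of \<open>w \<Sum>\<^sub>k\<^sub>l X\<^sub>k T\<^sub>k\<^sub>l V\<^sub>l\<close>, with bases and ranks taken from \<open>A\<close>, to the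
  state \<open>z'\<close>. The non-conserved columns \<open>m+1, \<dots>, rV A\<close> are renumbered as \<open>1, \<dots>, rV A - m\<close>
  in \<open>Xr\<close>, \<open>Sr\<close> and in the SVD.
\<close>

definition conservative_truncation ::
    "('x, 'v, 'd::finite) calculus \<Rightarrow> nat \<Rightarrow> nat \<Rightarrow> (nat \<Rightarrow> 'v \<Rightarrow> real) \<Rightarrow> ('x, 'v) augmented \<Rightarrow>
     (nat \<Rightarrow> nat \<Rightarrow> real) \<Rightarrow> ('x, 'v) lowrank \<Rightarrow> bool" where
  "conservative_truncation c m r U A T z' \<longleftrightarrow>
     (let Kt = (\<lambda>l x. \<Sum>k=1..rX A. aX A k x * T k l); q = rV A - m in
      \<exists>Xc Sc Xr Sr P s Q R.
        qr_factorization c m Kt Xc Sc \<and>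
        qr_factorization c q (\<lambda>b. Kt (m + b)) Xr Sr \<and>
        svd q Sr P s Q \<and>
        qr_factorization c r
          (\<lambda>a x. if a \<le> m then Xc a x else (\<Sum>b=1..q. Xr b x * P b (a - m))) (mX z') R \<and>
        (\<forall>i\<in>{1..r}. \<forall>j\<in>{1..r}. mS z' i j =
           (\<Sum>k=1..r. R i k *
              (if k \<le> m \<and> j \<le> m then Sc k j else if k = j then s (k - m) else 0))) \<and>
        (\<forall>a\<in>{1..m}. mV z' a = U a) \<and>
        (\<forall>p\<in>{m+1..r}. mV z' p = (\<lambda>v. \<Sum>b=1..q. aV A (m + b) v * Q b (p - m))))"

text \<open>
  One step from \<open>z\<close> to \<open>z'\<close> driven by the increments \<open>\<Delta>\<close>: \<open>E\<close> is the field of the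
  current state, \<open>A\<close> are the augmented bases.
\<close>

definition bug_step ::
    "integrator \<Rightarrow> ('x, 'v, 'd::finite) calculus \<Rightarrow> ('v \<Rightarrow> real) \<Rightarrow>
     ('x \<Rightarrow> real ^ 'k::finite ^ 'd) \<Rightarrow> nat \<Rightarrow> nat \<Rightarrow> (nat \<Rightarrow> 'v \<Rightarrow> real) \<Rightarrow> real \<Rightarrow> ('k \<Rightarrow> real) \<Rightarrow>
     ('x, 'v) lowrank \<Rightarrow> ('x \<Rightarrow> real ^ 'd) \<Rightarrow> ('x, 'v) augmented \<Rightarrow> ('x, 'v) lowrank \<Rightarrow> bool" where
  "bug_step \<theta> c w \<sigma> m r U \<tau> \<Delta> z E A z' \<longleftrightarrow>
     electric_field c (lr_density w r z) E \<and>
     basis_augmentation c w m r U \<tau> (drift_incr c E (lr_density w r z))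
       (stoch_incr \<theta> c \<sigma> \<tau> \<Delta> (lr_density w r z)) z A \<and>
     (\<exists>E'. electric_field c (aug_density c w r z A) E' \<and>
        conservative_truncation c m r U A
          (S_next c w r \<tau> (drift_incr c E' (aug_density c w r z A))
            (stoch_incr \<theta> c \<sigma> \<tau> \<Delta> (aug_density c w r z A)) z A) z')"

definition projection_identities ::
    "('x, 'v, 'd::finite) calculus \<Rightarrow> ('v \<Rightarrow> real) \<Rightarrow> nat \<Rightarrow> ('x, 'v) lowrank \<Rightarrow> ('x, 'v) augmented \<Rightarrow> bool"
  where
  "projection_identities c w r z A \<longleftrightarrow>
     (\<forall>j\<in>{1..r}. \<forall>x. (\<Sum>i=1..rX A. innerX c (aX A i) (mX z j) * aX A i x) = mX z j x) \<and>
     (\<forall>l\<in>{1..r}. \<forall>v. (\<Sum>k=1..rV A. innerW c w (mV z l) (aV A k) * aV A k v) = mV z l v)"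



section \<open>Two calculi\<close>

text \<open>
  Exact calculus on \<open>T^d \<times> R^d\<close>, where \<open>T^d = R^d/Z^d\<close>: functions on the torus are
  functions on \<open>R^d\<close> with period 1 in every coordinate, integrated over the unit cell.
\<close>

definition partial :: "'d \<Rightarrow> (real ^ 'd::finite \<Rightarrow> real) \<Rightarrow> real ^ 'd \<Rightarrow> real" where
  "partial l g y = frechet_derivative g (at y) (axis l 1)"

definition C1_functions :: "(real ^ 'd::finite \<Rightarrow> real) set" where
  "C1_functions = {g. (\<forall>y. g differentiable (at y)) \<and> (\<forall>l. continuous_on UNIV (partial l g))}"

definition unit_periodic :: "(real ^ 'd::finite \<Rightarrow> real) \<Rightarrow> bool" where
  "unit_periodic g \<longleftrightarrow> (\<forall>l y. g (y + axis l 1) = g y)"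

definition unit_cell :: "(real ^ 'd::finite) set" where
  "unit_cell = {y. \<forall>l. 0 \<le> y $ l \<and> y $ l < 1}"

definition exact_calculus :: "(real ^ 'd::finite, real ^ 'd, 'd) calculus" where
  "exact_calculus = \<lparr>
     posM = restrict_space lborel unit_cell, velM = lborel, vel = (\<lambda>v. v),
     dX = partial, dV = partial,
     posC = {g. continuous_on UNIV g \<and> unit_periodic g},
     posD = {g \<in> C1_functions. unit_periodic g},
     velD = {g \<in> C1_functions. integrable lborel g \<and> (\<forall>l. integrable lborel (partial l g))}\<rparr>"

lemma partial_linear:
  assumes "g differentiable (at y)" "h differentiable (at y)"
  shows "partial l (\<lambda>y. a * g y + b * h y) y = a * partial l g y + b * partial l h y"
proof -
  have "((\<lambda>y. a * g y + b * h y) has_derivative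
      (\<lambda>e. a * frechet_derivative g (at y) e + b * frechet_derivative h (at y) e)) (at y)"
    using assms by (auto intro!: derivative_intros simp: frechet_derivative_works)
  from frechet_derivative_at[OF this] show ?thesis
    by (simp add: partial_def fun_eq_iff)
qed

lemma C1_subspace: "fun_subspace C1_functions"
  unfolding fun_subspace_def C1_functions_def
proof (safe, goal_cases)
  case (2 l) 
  then show ?case by (simp add: partial_def[abs_def])
next
  case (4 g h a b l)
  then have "partial l (\<lambda>y. a * g y + b * h y) = (\<lambda>y. a * partial l g y + b * partial l h y)"
    by (auto simp: fun_eq_iff partial_linear)
  with 4 show ?case by (auto intro!: continuous_intros)
qed (auto intro!: derivative_intros)

lemma C1_cont: "g \<in> C1_functions \<Longrightarrow> continuous_on UNIV g"
  unfolding C1_functions_def by (auto intro!: differentiable_imp_continuous_on simp: differentiable_on_def differentiable_at_withinI)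

lemma C1_partial_linear: "linear_op_on C1_functions (partial l)"
  by (auto simp: linear_op_on_def C1_functions_def partial_linear fun_eq_iff)

lemma partial_periodic:
  fixes g :: "real ^ 'd::finite \<Rightarrow> real"
  assumes "g \<in> C1_functions" "unit_periodic g"
  shows "unit_periodic (partial l g)"
  unfolding unit_periodic_def
proof (intro allI)
  fix k and y :: "real ^ 'd"
  let ?z = "y + axis k 1"
  have "(g has_derivative frechet_derivative g (at ?z)) (at ?z)"
    using assms(1) by (simp add: C1_functions_def frechet_derivative_works[symmetric])
  moreover have "((\<lambda>u. u + axis k 1) has_derivative (\<lambda>u. u)) (at y)"
    by (auto intro!: derivative_eq_intros)
  ultimately have "((\<lambda>u. g (u + axis k 1)) has_derivative frechet_derivative g (at ?z)) (at y)"
    by (rule has_derivative_compose[where f = "\<lambda>u. u + axis k 1" and f' = "\<lambda>u. u", rotated])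
  moreover have "(\<lambda>u. g (u + axis k 1)) = g" using assms(2) by (simp add: unit_periodic_def)
  ultimately have "frechet_derivative g (at ?z) = frechet_derivative g (at y)"
    by (simp add: frechet_derivative_at)
  then show "partial l g ?z = partial l g y" by (simp add: partial_def)
qed

lemma partial_FTC:
  assumes "g \<in> C1_functions"
  shows "(\<integral>t. partial l g (y + t *\<^sub>R axis l 1) * indicator {0..1} t \<partial>lborel) = g (y + axis l 1) - g y"
proof -
  have "(\<integral>t. partial l g (y + t *\<^sub>R axis l 1) * indicator {0..1} t \<partial>lborel)
      = g (y + 1 *\<^sub>R axis l 1) - g (y + 0 *\<^sub>R axis l 1)"
  proof (rule integral_FTC_Icc_real)
    fix t :: real
    have "(g has_derivative frechet_derivative g (at (y + t *\<^sub>R axis l 1))) (at (y + t *\<^sub>R axis l 1))"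
      using assms by (simp add: C1_functions_def frechet_derivative_works[symmetric])
    moreover have "((\<lambda>t. y + t *\<^sub>R axis l 1) has_derivative (\<lambda>s. s *\<^sub>R axis l 1)) (at t)"
      by (auto intro!: derivative_eq_intros)
    ultimately have "((\<lambda>t. g (y + t *\<^sub>R axis l 1)) has_derivative
       (\<lambda>s. frechet_derivative g (at (y + t *\<^sub>R axis l 1)) (s *\<^sub>R axis l 1))) (at t)"
      by (rule has_derivative_compose[where f = "\<lambda>t. y + t *\<^sub>R axis l 1", rotated])
    moreover have "(\<lambda>s. frechet_derivative g (at (y + t *\<^sub>R axis l 1)) (s *\<^sub>R axis l 1)) =
        (*) (partial l g (y + t *\<^sub>R axis l 1))"
    proof -
      have "linear (frechet_derivative g (at (y + t *\<^sub>R axis l 1)))"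
        using assms by (auto simp: C1_functions_def intro!: linear_frechet_derivative)
      then show ?thesis by (auto simp: partial_def linear_cmul fun_eq_iff mult.commute)
    qed
    ultimately show "((\<lambda>t. g (y + t *\<^sub>R axis l 1)) has_real_derivative partial l g (y + t *\<^sub>R axis l 1)) (at t)"
      by (simp add: has_field_derivative_def)
    show "isCont (\<lambda>t. partial l g (y + t *\<^sub>R axis l 1)) t"
    proof -
      have "continuous_on UNIV (\<lambda>t. partial l g (y + t *\<^sub>R axis l 1))"
      proof (rule continuous_on_compose2[where g = "partial l g" and t = UNIV])
        show "continuous_on UNIV (partial l g)" using assms by (simp add: C1_functions_def)
      qed (auto intro!: continuous_intros)
      then show ?thesis by (simp add: continuous_on_eq_continuous_at)
    qed
  qed simp
  then show ?thesis by simp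
qed

text \<open>Averaging a difference \<open>g (y + e\<^sub>l) - g y = \<integral>\<^sub>0\<^sup>1 \<partial>\<^sub>l g (y + t e\<^sub>l) dt\<close> over a set on which integrals
  of \<open>\<partial>\<^sub>l g\<close> are invariant under translation by \<open>t e\<^sub>l\<close>.\<close>

lemma integral_partial_shift:
  fixes S :: "(real ^ 'd::finite) set"
  assumes g: "g \<in> C1_functions" and S[measurable]: "S \<in> sets borel"
    and int: "\<And>t. 0 \<le> t \<Longrightarrow> t \<le> 1 \<Longrightarrow> integrable lborel (\<lambda>y. indicator S y * partial l g (y + t *\<^sub>R axis l 1))"
    and I: "\<And>t. 0 \<le> t \<Longrightarrow> t \<le> 1 \<Longrightarrow> (\<integral>y. indicator S y * partial l g (y + t *\<^sub>R axis l 1) \<partial>lborel) = I"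
    and J: "\<And>t. 0 \<le> t \<Longrightarrow> t \<le> 1 \<Longrightarrow> (\<integral>y. indicator S y * \<bar>partial l g (y + t *\<^sub>R axis l 1)\<bar> \<partial>lborel) = J"
  shows "(\<integral>y. indicator S y * (g (y + axis l 1) - g y) \<partial>lborel) = I"
proof -
  define \<Phi> where "\<Phi> = (\<lambda>(t::real) y. indicator {0..1} t * (indicator S y * partial l g (y + t *\<^sub>R axis l 1)))"
  have [measurable]: "partial l g \<in> borel_measurable borel"
    using g by (auto simp: C1_functions_def intro!: borel_measurable_continuous_onI)
  have m: "case_prod \<Phi> \<in> borel_measurable (lborel \<Otimes>\<^sub>M lborel)"
    unfolding \<Phi>_def by measurable
  have n: "(\<integral>y. norm (\<Phi> t y) \<partial>lborel) = indicator {0..1} t * J" for t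
    using J[of t] by (auto simp: \<Phi>_def indicator_def abs_mult cong: if_cong)
  have "integrable (lborel \<Otimes>\<^sub>M lborel) (case_prod \<Phi>)"
  proof (rule lborel_pair.Fubini_integrable[OF m])
    show "integrable lborel (\<lambda>t. \<integral>y. norm (case_prod \<Phi> (t, y)) \<partial>lborel)"
      unfolding prod.case n by simp
    show "AE t in lborel. integrable lborel (\<lambda>y. case_prod \<Phi> (t, y))"
      using int by (auto simp: \<Phi>_def indicator_def cong: if_cong)
  qed
  from lborel_pair.Fubini_integral[OF this]
  have "(\<integral>y. \<integral>t. \<Phi> t y \<partial>lborel \<partial>lborel) = (\<integral>t. \<integral>y. \<Phi> t y \<partial>lborel \<partial>lborel)" .
  also have "(\<lambda>t. \<integral>y. \<Phi> t y \<partial>lborel) = (\<lambda>t. indicator {0..1} t * I)"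
    using I by (auto simp: \<Phi>_def indicator_def fun_eq_iff)
  also have "(\<integral>t. indicator {0..1::real} t * I \<partial>lborel) = I" by simp
  also have "(\<lambda>y. \<integral>t. \<Phi> t y \<partial>lborel) = (\<lambda>y. indicator S y * (g (y + axis l 1) - g y))"
  proof
    fix y
    have "(\<integral>t. \<Phi> t y \<partial>lborel) = (\<integral>t. indicator S y * (partial l g (y + t *\<^sub>R axis l 1) * indicator {0..1} t) \<partial>lborel)"
      by (intro Bochner_Integration.integral_cong) (auto simp: \<Phi>_def)
    also have "\<dots> = indicator S y * (g (y + axis l 1) - g y)"
      by (simp add: partial_FTC[OF g])
    finally show "(\<integral>t. \<Phi> t y \<partial>lborel) = indicator S y * (g (y + axis l 1) - g y)" .
  qed
  finally show ?thesis .
qed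

lemma lborel_shift:
  fixes q :: "'a::euclidean_space \<Rightarrow> real"
  assumes [measurable]: "q \<in> borel_measurable borel"
  shows "(\<integral>y. q (y + e) \<partial>lborel) = (\<integral>y. q y \<partial>lborel)"
    "integrable lborel (\<lambda>y. q (y + e)) \<longleftrightarrow> integrable lborel q"
proof -
  have "(\<integral>y. q y \<partial>lborel) = (\<integral>y. q y \<partial>distr lborel borel ((+) e))"
    by (simp add: lborel_distr_plus)
  then show "(\<integral>y. q (y + e) \<partial>lborel) = (\<integral>y. q y \<partial>lborel)"
    by (simp add: integral_distr add.commute)
  have "integrable lborel q \<longleftrightarrow> integrable (distr lborel borel ((+) e)) q"
    by (simp add: lborel_distr_plus)
  then show "integrable lborel (\<lambda>y. q (y + e)) \<longleftrightarrow> integrable lborel q"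
    by (simp add: integrable_distr_eq add.commute)
qed

lemma unit_cell_borel[measurable]: "unit_cell \<in> sets borel"
  unfolding unit_cell_def by measurable

lemma bounded_integrable:
  fixes q :: "real ^ 'd::finite \<Rightarrow> real"
  assumes q: "continuous_on UNIV q" and [measurable]: "S \<in> sets borel"
    and S: "\<And>y l. y \<in> S \<Longrightarrow> -2 \<le> y $ l \<and> y $ l \<le> 2"
  shows "integrable lborel (\<lambda>y. indicator S y * q y)"
proof -
  let ?C = "cbox (\<chi> l. -2) (\<chi> l. 2) :: (real ^ 'd) set"
  have "S \<subseteq> ?C" using S by (auto simp: mem_box_cart)
  have "integrable lborel (\<lambda>y. indicator ?C y *\<^sub>R q y)"
    using q by (intro borel_integrable_compact) (auto intro: continuous_on_subset)
  then have "integrable lborel (\<lambda>y. indicator S y *\<^sub>R (indicator ?C y *\<^sub>R q y))"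
    by (rule integrable_mult_indicator[rotated]) simp
  moreover have "(\<lambda>y. indicator S y *\<^sub>R (indicator ?C y *\<^sub>R q y)) = (\<lambda>y. indicator S y * q y)"
    using \<open>S \<subseteq> ?C\<close> by (auto simp: fun_eq_iff indicator_def)
  ultimately show ?thesis by simp
qed

lemma unit_cell_shift:
  fixes q :: "real ^ 'd::finite \<Rightarrow> real"
  assumes q: "continuous_on UNIV q" "unit_periodic q" and t: "0 \<le> t" "t \<le> 1"
  shows "integrable lborel (\<lambda>y. indicator unit_cell y * q (y + t *\<^sub>R axis l 1))"
    "(\<integral>y. indicator unit_cell y * q (y + t *\<^sub>R axis l 1) \<partial>lborel) = (\<integral>y. indicator unit_cell y * q y \<partial>lborel)"
proof -
  define e :: "real ^ 'd" where "e = axis l 1"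
  have [measurable]: "q \<in> borel_measurable borel"
    using q by (intro borel_measurable_continuous_onI)
  have ax: "axis l (1::real) $ k = (if k = l then 1 else 0)" for k by (simp add: axis_def)
  define B where "B = {y :: real ^ 'd. y \<in> unit_cell \<and> t \<le> y $ l}"
  define B' where "B' = {y :: real ^ 'd. y \<in> unit_cell \<and> y $ l < t}"
  define C where "C = {y :: real ^ 'd. y - e \<in> B'}"
  have [measurable]: "B \<in> sets borel" "B' \<in> sets borel" "C \<in> sets borel"
    unfolding B_def B'_def C_def by measurable
  have bB: "y \<in> B \<Longrightarrow> -2 \<le> y $ k \<and> y $ k \<le> 2" and bB': "y \<in> B' \<Longrightarrow> -2 \<le> y $ k \<and> y $ k \<le> 2" for y k
    by (auto simp: B_def B'_def unit_cell_def intro: order_trans[of _ 0] order_trans[of _ 1] dest!: spec[of _ k])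
  have bC: "-2 \<le> y $ k \<and> y $ k \<le> 2" if "y \<in> C" for y k
  proof -
    from that have "0 \<le> (y - e) $ k" "(y - e) $ k < 1" by (auto simp: C_def B'_def unit_cell_def)
    then show ?thesis by (auto simp: e_def ax split: if_splits)
  qed
  have iB: "integrable lborel (\<lambda>y. indicator B y * q y)"
    and iB': "integrable lborel (\<lambda>y. indicator B' y * q y)"
    and iC: "integrable lborel (\<lambda>y. indicator C y * q y)"
    using bB bB' bC q(1) by (auto intro!: bounded_integrable)
  have split: "indicator unit_cell (y - t *\<^sub>R e) = indicator B y + (indicator C y :: real)" for y
  proof -
    have 1: "y - t *\<^sub>R e \<in> unit_cell \<longleftrightarrow>
       t \<le> y $ l \<and> y $ l < 1 + t \<and> (\<forall>k. k \<noteq> l \<longrightarrow> 0 \<le> y $ k \<and> y $ k < 1)"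
      unfolding unit_cell_def e_def by (auto simp: ax split: if_splits)
    have 2: "y \<in> B \<longleftrightarrow> t \<le> y $ l \<and> y $ l < 1 \<and> (\<forall>k. k \<noteq> l \<longrightarrow> 0 \<le> y $ k \<and> y $ k < 1)"
    proof safe
      assume "y \<in> B"
      then show "t \<le> y $ l" "y $ l < 1" "\<And>k. 0 \<le> y $ k" "\<And>k. y $ k < 1"
        by (simp_all add: B_def unit_cell_def)
    next
      assume *: "t \<le> y $ l" "y $ l < 1" "\<forall>k. k \<noteq> l \<longrightarrow> 0 \<le> y $ k \<and> y $ k < 1"
      then have "0 \<le> y $ k \<and> y $ k < 1" for k using t by (cases "k = l") auto
      with * show "y \<in> B" by (simp add: B_def unit_cell_def)
    qed
    have 3: "y \<in> C \<longleftrightarrow> 1 \<le> y $ l \<and> y $ l < 1 + t \<and> (\<forall>k. k \<noteq> l \<longrightarrow> 0 \<le> y $ k \<and> y $ k < 1)"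
      unfolding unit_cell_def C_def B'_def e_def using t by (auto simp: ax split: if_splits)
    show ?thesis using 1 2 3 t by (auto simp: indicator_def)
  qed
  have S: "(\<lambda>y. indicator unit_cell y * q (y + t *\<^sub>R e))
     = (\<lambda>y. (\<lambda>z. indicator B z * q z + indicator C z * q z) (y + t *\<^sub>R e))"
  proof
    fix y show "indicator unit_cell y * q (y + t *\<^sub>R e) =
       (\<lambda>z. indicator B z * q z + indicator C z * q z) (y + t *\<^sub>R e)"
      using split[of "y + t *\<^sub>R e"] by (simp add: distrib_right)
  qed
  have "integrable lborel (\<lambda>y. indicator unit_cell y * q (y + t *\<^sub>R e))"
    unfolding S using iB iC by (subst lborel_shift(2)) auto
  then show "integrable lborel (\<lambda>y. indicator unit_cell y * q (y + t *\<^sub>R axis l 1))" by (simp add: e_def)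
  have "(\<integral>y. indicator unit_cell y * q (y + t *\<^sub>R e) \<partial>lborel)
     = (\<integral>z. indicator B z * q z + indicator C z * q z \<partial>lborel)"
    unfolding S by (subst lborel_shift(1)) auto
  also have "\<dots> = (\<integral>z. indicator B z * q z \<partial>lborel) + (\<integral>z. indicator C z * q z \<partial>lborel)"
    using iB iC by simp
  also have "(\<integral>z. indicator C z * q z \<partial>lborel) = (\<integral>z. indicator C (z + e) * q (z + e) \<partial>lborel)"
    using lborel_shift(1)[of "\<lambda>z. indicator C z * q z" e] by simp
  also have "(\<lambda>z. indicator C (z + e) * q (z + e)) = (\<lambda>z. indicator B' z * q z)"
    using q(2) by (auto simp: fun_eq_iff C_def indicator_def e_def unit_periodic_def)
  also have "(\<integral>z. indicator B z * q z \<partial>lborel) + (\<integral>z. indicator B' z * q z \<partial>lborel)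
     = (\<integral>z. indicator B z * q z + indicator B' z * q z \<partial>lborel)"
    using iB iB' by simp
  also have "(\<lambda>z. indicator B z * q z + indicator B' z * q z) = (\<lambda>z. indicator unit_cell z * q z)"
    by (auto simp: fun_eq_iff B_def B'_def indicator_def)
  finally show "(\<integral>y. indicator unit_cell y * q (y + t *\<^sub>R axis l 1) \<partial>lborel) = (\<integral>y. indicator unit_cell y * q y \<partial>lborel)"
    by (simp add: e_def)
qed

lemma exact_calculus_rules:
  "calculus_rules (exact_calculus :: (real ^ 'd::finite, real ^ 'd, 'd) calculus)"
proof (rule calculus_rules.intro)
  let ?c = "exact_calculus :: (real ^ 'd::finite, real ^ 'd, 'd) calculus"
  have cell: "integrable (restrict_space lborel unit_cell) q \<longleftrightarrow> integrable lborel (\<lambda>y. indicator unit_cell y * q y)"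
    "(\<integral>y. q y \<partial>restrict_space lborel unit_cell) = (\<integral>y. indicator unit_cell y * q y \<partial>lborel)"
    for q :: "real ^ 'd \<Rightarrow> real"
    by (subst integrable_restrict_space, simp_all) (subst integral_restrict_space, simp_all)
  show "sigma_finite_measure (posM ?c)"
    unfolding exact_calculus_def calculus.simps
    by (rule sigma_finite_measure_restrict_space) (auto intro: sigma_finite_lborel)
  show "sigma_finite_measure (velM ?c)"
    by (simp add: exact_calculus_def sigma_finite_lborel)
  show "fun_subspace (posC ?c)"
    by (auto simp: exact_calculus_def fun_subspace_def unit_periodic_def intro!: continuous_intros)
  show "(\<lambda>_. 1) \<in> posC ?c"
    by (auto simp: exact_calculus_def unit_periodic_def)
  show "(\<lambda>x. g x * h x) \<in> posC ?c" if "g \<in> posC ?c" "h \<in> posC ?c" for g h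
    using that by (auto simp: exact_calculus_def unit_periodic_def intro!: continuous_intros)
  show "integrable (posM ?c) g" if "g \<in> posC ?c" for g
    using that unit_cell_shift(1)[of g 0] by (auto simp: exact_calculus_def cell)
  show "fun_subspace (posD ?c)"
    using C1_subspace by (auto simp: exact_calculus_def fun_subspace_def unit_periodic_def)
  show "posD ?c \<subseteq> posC ?c"
    by (auto simp: exact_calculus_def C1_cont)
  show "linear_op_on (posD ?c) (dX ?c l)" for l
    using C1_partial_linear[of l] by (auto simp: exact_calculus_def linear_op_on_def)
  show "dX ?c l u \<in> posC ?c" if "u \<in> posD ?c" for l u
    using that by (auto simp: exact_calculus_def partial_periodic) (auto simp: C1_functions_def)
  show "(\<integral>x. dX ?c l u x \<partial>posM ?c) = 0" if "u \<in> posD ?c" for l u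
  proof -
    have u: "u \<in> C1_functions" "unit_periodic u" using that by (auto simp: exact_calculus_def)
    have p: "continuous_on UNIV (partial l u)" "unit_periodic (partial l u)"
      using u partial_periodic by (auto simp: C1_functions_def)
    have a: "continuous_on UNIV (\<lambda>y. \<bar>partial l u y\<bar>)" "unit_periodic (\<lambda>y. \<bar>partial l u y\<bar>)"
      using p by (auto intro!: continuous_intros simp: unit_periodic_def)
    have "(\<integral>y. indicator unit_cell y * partial l u y \<partial>lborel) =
       (\<integral>y. indicator unit_cell y * (u (y + axis l 1) - u y) \<partial>lborel)"
      by (rule integral_partial_shift[symmetric, OF u(1) unit_cell_borel
            unit_cell_shift(1)[OF p] unit_cell_shift(2)[OF p] unit_cell_shift(2)[OF a]])
    also have "\<dots> = 0" using u(2) by (simp add: unit_periodic_def)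
    finally show ?thesis by (simp add: exact_calculus_def cell)
  qed
  show "fun_subspace (velD ?c)"
  proof -
    have "partial l (\<lambda>y. a * g y + b * h y) = (\<lambda>y. a * partial l g y + b * partial l h y)"
      if "g \<in> C1_functions" "h \<in> C1_functions" for a b l and g h :: "real ^ 'd \<Rightarrow> real"
      using C1_partial_linear[of l] that by (simp add: linear_op_on_def)
    moreover have "partial l (\<lambda>_. 0) = (\<lambda>_. 0)" for l :: 'd
      by (simp add: partial_def[abs_def])
    ultimately show ?thesis
      using C1_subspace by (auto simp: exact_calculus_def fun_subspace_def)
  qed
  show "linear_op_on (velD ?c) (dV ?c l)" for l
    using C1_partial_linear[of l] by (auto simp: exact_calculus_def linear_op_on_def)
  show "integrable (velM ?c) (dV ?c l g)" if "g \<in> velD ?c" for l g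
    using that by (auto simp: exact_calculus_def)
  show "(\<integral>v. dV ?c l g v \<partial>velM ?c) = 0" if "g \<in> velD ?c" for l g
  proof -
    have g: "g \<in> C1_functions" "integrable lborel g" "integrable lborel (partial l g)"
      using that by (auto simp: exact_calculus_def)
    have [measurable]: "partial l g \<in> borel_measurable borel" "g \<in> borel_measurable borel"
      using g(1) C1_cont[OF g(1)] by (auto simp: C1_functions_def intro!: borel_measurable_continuous_onI)
    have "(\<integral>y. indicator UNIV y * (g (y + axis l 1) - g y) \<partial>lborel) = (\<integral>y. partial l g y \<partial>lborel)"
    proof (rule integral_partial_shift[OF g(1), where J = "\<integral>y. \<bar>partial l g y\<bar> \<partial>lborel"])
      fix t :: real
      show "integrable lborel (\<lambda>y. indicator UNIV y * partial l g (y + t *\<^sub>R axis l 1))"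
        using g(3) by (simp add: lborel_shift(2))
      show "(\<integral>y. indicator UNIV y * partial l g (y + t *\<^sub>R axis l 1) \<partial>lborel) = (\<integral>y. partial l g y \<partial>lborel)"
        by (simp add: lborel_shift(1))
      show "(\<integral>y. indicator UNIV y * \<bar>partial l g (y + t *\<^sub>R axis l 1)\<bar> \<partial>lborel) = (\<integral>y. \<bar>partial l g y\<bar> \<partial>lborel)"
        using lborel_shift(1)[of "\<lambda>y. \<bar>partial l g y\<bar>" "t *\<^sub>R axis l 1"] by simp
    qed simp
    moreover have "(\<integral>y. g (y + axis l 1) - g y \<partial>lborel) = 0"
      using g(2) by (subst Bochner_Integration.integral_diff) (auto simp: lborel_shift)
    ultimately show ?thesis by (simp add: exact_calculus_def)
  qed
qed


text \<open>Centered differences with mesh width \<open>h\<close>.\<close>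

definition centered_difference ::
    "real \<Rightarrow> 'd \<Rightarrow> ('a::comm_ring_1 ^ 'd::finite \<Rightarrow> real) \<Rightarrow> 'a ^ 'd \<Rightarrow> real" where
  "centered_difference h l g y = (g (y + axis l 1) - g (y - axis l 1)) / (2 * h)"

definition grid_measure :: "real \<Rightarrow> ('a ^ 'd::finite) measure" where
  "grid_measure h = density (count_space UNIV) (\<lambda>_. ennreal (h ^ CARD('d)))"

text \<open>
  The position grid is \<open>(Z/nZ)^d\<close> for a finite ring \<open>'a\<close> such as the numeral types, the
  velocity grid is the unbounded lattice \<open>h Z^d\<close>.
\<close>

definition grid_calculus :: "real \<Rightarrow> real \<Rightarrow> ('a::{finite, comm_ring_1} ^ 'd::finite, int ^ 'd, 'd) calculus" where
  "grid_calculus hx hv = \<lparr>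
     posM = grid_measure hx, velM = grid_measure hv, vel = (\<lambda>k. \<chi> l. hv * of_int (k $ l)),
     dX = centered_difference hx, dV = centered_difference hv,
     posC = UNIV, posD = UNIV, velD = {g. integrable (grid_measure hv) g}\<rparr>"

lemma grid_measure_sigma_finite: "sigma_finite_measure (grid_measure h :: ('a::countable ^ 'd::finite) measure)"
proof
  have "(\<integral>\<^sup>+ x. c * indicator {y} x \<partial>count_space UNIV) = c" for c and y :: "'a ^ 'd"
    by (subst nn_integral_cmult) auto
  then show "\<exists>A. countable A \<and> A \<subseteq> sets (grid_measure h :: ('a ^ 'd) measure) \<and>
      \<Union> A = space (grid_measure h) \<and> (\<forall>a\<in>A. emeasure (grid_measure h) a \<noteq> \<infinity>)"
    by (intro exI[of _ "range (\<lambda>y::'a ^ 'd. {y})"])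
       (auto simp: grid_measure_def emeasure_density)
qed

lemma grid_measure_shift:
  fixes g :: "'a::comm_ring_1 ^ 'd::finite \<Rightarrow> real"
  assumes "0 < h"
  shows "(\<integral>y. g (y + e) \<partial>grid_measure h) = (\<integral>y. g y \<partial>grid_measure h)"
    "integrable (grid_measure h) (\<lambda>y. g (y + e)) \<longleftrightarrow> integrable (grid_measure h) g"
proof -
  have b: "bij_betw (\<lambda>y. y + e) (UNIV :: ('a ^ 'd) set) UNIV"
    by (rule bij_betwI[where g = "\<lambda>y. y - e"]) auto
  show "(\<integral>y. g (y + e) \<partial>grid_measure h) = (\<integral>y. g y \<partial>grid_measure h)"
    using assms integral_bij_count_space[OF b, of g] by (simp add: grid_measure_def integral_density)
  show "integrable (grid_measure h) (\<lambda>y. g (y + e)) \<longleftrightarrow> integrable (grid_measure h) g"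
    using assms integrable_bij_count_space[OF b, of g] by (simp add: grid_measure_def integrable_density)
qed

lemma grid_measure_centered_difference:
  fixes g :: "'a::comm_ring_1 ^ 'd::finite \<Rightarrow> real"
  assumes "0 < h" "integrable (grid_measure h) g"
  shows "integrable (grid_measure h) (centered_difference h l g)"
    "(\<integral>y. centered_difference h l g y \<partial>grid_measure h) = 0"
proof -
  have "integrable (grid_measure h) (\<lambda>y. g (y + axis l 1))" "integrable (grid_measure h) (\<lambda>y. g (y - axis l 1))"
    using assms grid_measure_shift(2)[of h g "axis l 1"] grid_measure_shift(2)[of h g "- axis l 1"] by simp_all
  moreover have "(\<integral>y. g (y + axis l 1) \<partial>grid_measure h) = (\<integral>y. g (y - axis l 1) \<partial>grid_measure h)"
    using assms grid_measure_shift(1)[of h g "axis l 1"] grid_measure_shift(1)[of h g "- axis l 1"] by simp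
  ultimately show "integrable (grid_measure h) (centered_difference h l g)"
    "(\<integral>y. centered_difference h l g y \<partial>grid_measure h) = 0"
    unfolding centered_difference_def by simp_all
qed

lemma grid_calculus_rules:
  assumes "0 < hx" "0 < hv"
  shows "calculus_rules (grid_calculus hx hv :: ('a::{finite, comm_ring_1} ^ 'd::finite, int ^ 'd, 'd) calculus)"
proof (rule calculus_rules.intro)
  let ?c = "grid_calculus hx hv :: ('a::{finite, comm_ring_1} ^ 'd::finite, int ^ 'd, 'd) calculus"
  have int: "integrable (grid_measure hx) g" for g :: "'a ^ 'd \<Rightarrow> real"
    using assms by (simp add: grid_measure_def integrable_density integrable_count_space)
  have lin: "linear_op_on B (centered_difference h l)"
    for B :: "('b::comm_ring_1 ^ 'd \<Rightarrow> real) set" and h and l :: 'd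
    by (auto simp: linear_op_on_def centered_difference_def fun_eq_iff diff_divide_distrib add_divide_distrib algebra_simps)
  show "sigma_finite_measure (posM ?c)" "sigma_finite_measure (velM ?c)"
    by (simp_all add: grid_calculus_def grid_measure_sigma_finite)
  show "linear_op_on (posD ?c) (dX ?c l)" "linear_op_on (velD ?c) (dV ?c l)" for l
    by (simp_all add: grid_calculus_def lin)
  show "(\<integral>x. dX ?c l u x \<partial>posM ?c) = 0" for l u
    using assms by (simp add: grid_calculus_def grid_measure_centered_difference int)
  show "integrable (posM ?c) g" for g :: "'a ^ 'd \<Rightarrow> real"
    by (simp add: grid_calculus_def int)
qed (use assms in \<open>auto simp: grid_calculus_def fun_subspace_def grid_measure_centered_difference\<close>)

end

theory Submission
  imports Defs
begin

text \<open>
  The constant mode is the first velocity mode, so \<open>\<rho>\<close> is \<open>\<parallel>1\<parallel>\<^sub>v\<close> times the coefficient function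
  of that mode, which the truncation keeps exactly. By the projection identities the augmented
  density is the old one, hence the S-step changes \<open>\<rho>\<close> by the projection onto the augmented
  position basis of the velocity integral of the increments. The stochastic and the electric
  parts are velocity derivatives and integrate to 0, while transport gives \<open>- \<tau> \<nabla>\<cdot>J\<close>, which lies
  in the augmented space because the derivatives of the position modes do.
\<close>

section \<open>Finite sums of products of a function of position and a function of velocity\<close>

text \<open>Low-rank densities and their increments are sums of this shape. Keeping the class
  \<open>C\<close> of position factors apart from the class \<open>B\<close> of velocity factors
  lets regularity, vanishing mean or span membership be propagated by choosing the classes.
  Induction over the sum then replaces analytic limit theorems.\<close>

inductive_set separable :: "('x \<Rightarrow> real) set \<Rightarrow> ('v \<Rightarrow> real) set \<Rightarrow> ('x \<Rightarrow> 'v \<Rightarrow> real) set"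
  for C :: "('x \<Rightarrow> real) set" and B :: "('v \<Rightarrow> real) set" where
  zero: "(\<lambda>_ _. 0) \<in> separable C B"
| tensor_add: "a \<in> C \<Longrightarrow> b \<in> B \<Longrightarrow> h \<in> separable C B \<Longrightarrow> (\<lambda>x v. a x * b v + h x v) \<in> separable C B"

section \<open>Function subspaces and linear operators on them\<close>

lemma fun_subspaceD:
  assumes "fun_subspace A"
  shows fun_subspace_zero: "(\<lambda>_. 0) \<in> A"
    and fun_subspace_lincomb: "g \<in> A \<Longrightarrow> h \<in> A \<Longrightarrow> (\<lambda>y. a * g y + b * h y) \<in> A"
    and fun_subspace_scale: "g \<in> A \<Longrightarrow> (\<lambda>y. a * g y) \<in> A"
    and fun_subspace_add: "g \<in> A \<Longrightarrow> h \<in> A \<Longrightarrow> (\<lambda>y. g y + h y) \<in> A"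
proof -
  show z: "(\<lambda>_. 0) \<in> A" using assms by (simp add: fun_subspace_def)
  show lc: "(\<lambda>y. a * g y + b * h y) \<in> A" if "g \<in> A" "h \<in> A" for g h a b
    using assms that by (simp add: fun_subspace_def)
  show "(\<lambda>y. a * g y) \<in> A" if "g \<in> A" using lc[OF that z, of a 0] by simp
  show "(\<lambda>y. g y + h y) \<in> A" if "g \<in> A" "h \<in> A" using lc[OF that, of 1 1] by simp
qed

lemma fun_subspace_sum:
  assumes "fun_subspace A" "\<And>i. i \<in> I \<Longrightarrow> g i \<in> A"
  shows "(\<lambda>y. \<Sum>i\<in>I. g i y) \<in> A"
  using assms(2)
  by (induction I rule: infinite_finite_induct)
     (auto simp: fun_subspace_zero[OF assms(1)] intro: fun_subspace_add[OF assms(1)])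

lemma linear_op_on_zero:
  assumes "linear_op_on A T" "g \<in> A"
  shows "T (\<lambda>_. 0) = (\<lambda>_. 0)"
proof -
  have "T (\<lambda>y. 0 * g y + 0 * g y) = (\<lambda>y. 0 * T g y + 0 * T g y)"
    using assms unfolding linear_op_on_def by blast
  then show ?thesis by simp
qed

lemma linear_op_on_scale_add:
  assumes "linear_op_on A T" "g \<in> A" "h \<in> A"
  shows "T (\<lambda>y. a * g y + h y) = (\<lambda>y. a * T g y + T h y)"
proof -
  have "T (\<lambda>y. a * g y + 1 * h y) = (\<lambda>y. a * T g y + 1 * T h y)"
    using assms unfolding linear_op_on_def by blast
  then show ?thesis by simp
qed

text \<open>Coefficient vectors combine linearly. Span membership thereby becomes an admissible
  condition on position factors.\<close>

lemma in_span_subspace: "fun_subspace {g. in_span n B g}"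
proof -
  have "in_span n B (\<lambda>_. 0)"
    unfolding in_span_def by (rule exI[of _ "\<lambda>_. 0"]) simp
  moreover have "in_span n B (\<lambda>y. a * g y + b * h y)" if "in_span n B g" "in_span n B h" for g h a b
  proof -
    from that obtain p q where "g = (\<lambda>y. \<Sum>k=1..n. p k * B k y)" "h = (\<lambda>y. \<Sum>k=1..n. q k * B k y)"
      by (auto simp: in_span_def)
    then show ?thesis
      unfolding in_span_def
      by (intro exI[of _ "\<lambda>k. a * p k + b * q k"])
         (simp add: fun_eq_iff sum_distrib_left sum.distrib[symmetric] algebra_simps)
  qed
  ultimately show ?thesis by (simp add: fun_subspace_def)
qed

section \<open>Closure properties of separable functions\<close>

lemma separable_tensor: "a \<in> C \<Longrightarrow> b \<in> B \<Longrightarrow> (\<lambda>x v. a x * b v) \<in> separable C B"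
  using separable.tensor_add[OF _ _ separable.zero] by fastforce

lemma separable_add:
  assumes "g \<in> separable C B" "h \<in> separable C B"
  shows "(\<lambda>x v. g x v + h x v) \<in> separable C B"
  using assms(1)
proof induction
  case (tensor_add a b g)
  then show ?case
    using separable.tensor_add[OF tensor_add(1,2) tensor_add.IH] by (simp add: add.assoc)
qed (simp add: assms)

lemma separable_sum:
  assumes "\<And>i. i \<in> I \<Longrightarrow> g i \<in> separable C B"
  shows "(\<lambda>x v. \<Sum>i\<in>I. g i x v) \<in> separable C B"
  using assms
  by (induction I rule: infinite_finite_induct) (auto intro: separable_add separable.zero)

lemma separable_mono: "h \<in> separable C B \<Longrightarrow> C \<subseteq> C' \<Longrightarrow> B \<subseteq> B' \<Longrightarrow> h \<in> separable C' B'"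
  by (induction rule: separable.induct) (auto intro: separable.intros)

lemma separable_mult_pos:
  assumes "h \<in> separable C B" "\<And>a. a \<in> C \<Longrightarrow> (\<lambda>x. p x * a x) \<in> C'"
  shows "(\<lambda>x v. p x * h x v) \<in> separable C' B"
  using assms(1)
proof induction
  case (tensor_add a b h)
  then show ?case
    using separable.tensor_add[OF assms(2)[OF tensor_add(1)] tensor_add(2) tensor_add.IH]
    by (simp add: algebra_simps)
qed (simp add: separable.zero)

lemma separable_mult_vel:
  assumes "h \<in> separable C B" "\<And>b. b \<in> B \<Longrightarrow> (\<lambda>v. p v * b v) \<in> B'"
  shows "(\<lambda>x v. p v * h x v) \<in> separable C B'"
  using assms(1)
proof induction
  case (tensor_add a b h)
  then show ?case
    using separable.tensor_add[OF tensor_add(1) assms(2)[OF tensor_add(2)] tensor_add.IH]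
    by (simp add: algebra_simps)
qed (simp add: separable.zero)

lemma separable_slice_vel: "h \<in> separable C B \<Longrightarrow> fun_subspace B \<Longrightarrow> h x \<in> B"
  by (induction rule: separable.induct)
     (auto simp: fun_subspace_zero intro!: fun_subspace_add fun_subspace_scale)

lemma separable_slice_pos: "h \<in> separable C B \<Longrightarrow> fun_subspace C \<Longrightarrow> (\<lambda>x. h x v) \<in> C"
proof (induction rule: separable.induct)
  case (tensor_add a b h)
  then show ?case
    using fun_subspace_add[OF tensor_add(5) fun_subspace_scale[OF tensor_add(5,1), of "b v"] tensor_add.IH]
    by (simp add: mult.commute)
qed (simp add: fun_subspace_zero)

text \<open>For fixed \<open>x\<close> the factor \<open>a x\<close> is a scalar, so linearity of
  \<open>T\<close> suffices to move it out. This is how functions of position commute with velocity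
  derivatives without a product rule.\<close>

lemma separable_op_vel:
  assumes "h \<in> separable C B" and B: "fun_subspace B" and T: "linear_op_on B T"
    and B': "\<And>b. b \<in> B \<Longrightarrow> T b \<in> B'"
  shows "(\<lambda>x v. T (h x) v) \<in> separable C B'"
  using assms(1)
proof induction
  case (tensor_add a b h)
  have "T (\<lambda>v. a x * b v + h x v) = (\<lambda>v. a x * T b v + T (h x) v)" for x
    by (rule linear_op_on_scale_add[OF T tensor_add(2) separable_slice_vel[OF tensor_add(3) B]])
  then show ?case
    using separable.tensor_add[OF tensor_add(1) B'[OF tensor_add(2)] tensor_add.IH] by simp
qed (simp add: linear_op_on_zero[OF T fun_subspace_zero[OF B]] separable.zero)

lemma separable_op_pos:
  assumes "h \<in> separable C B" and C: "fun_subspace C" and T: "linear_op_on C T"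
    and C': "\<And>a. a \<in> C \<Longrightarrow> T a \<in> C'"
  shows "(\<lambda>x v. T (\<lambda>y. h y v) x) \<in> separable C' B"
  using assms(1)
proof induction
  case (tensor_add a b h)
  have "T (\<lambda>x. a x * b v + h x v) = (\<lambda>x. T a x * b v + T (\<lambda>x. h x v) x)" for v
    using linear_op_on_scale_add[OF T tensor_add(1) separable_slice_pos[OF tensor_add(3) C], of "b v"]
    by (simp add: mult.commute)
  then show ?case
    using separable.tensor_add[OF C'[OF tensor_add(1)] tensor_add(2) tensor_add.IH] by simp
qed (simp add: linear_op_on_zero[OF T fun_subspace_zero[OF C]] separable.zero)

lemma separable_lr_density:
  assumes C: "fun_subspace C" and X: "\<And>i. i \<in> {1..r} \<Longrightarrow> mX z i \<in> C"
    and V: "\<And>j. j \<in> {1..r} \<Longrightarrow> (\<lambda>v. w v * mV z j v) \<in> B"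
  shows "lr_density w r z \<in> separable C B"
proof -
  have "(\<lambda>x v. \<Sum>i=1..r. \<Sum>j=1..r. (mS z i j * mX z i x) * (w v * mV z j v)) \<in> separable C B"
    by (intro separable_sum separable_tensor fun_subspace_scale[OF C] X V)
  moreover have "lr_density w r z =
      (\<lambda>x v. \<Sum>i=1..r. \<Sum>j=1..r. (mS z i j * mX z i x) * (w v * mV z j v))"
    by (simp add: lr_density_def fun_eq_iff sum_distrib_left algebra_simps)
  ultimately show ?thesis by simp
qed

section \<open>Integration over velocity\<close>

text \<open>Integrating out \<open>v\<close> turns every velocity factor into a number, which leaves
  a linear combination of position factors.\<close>

lemma separable_velocity_integral:
  assumes "h \<in> separable C B" and C: "fun_subspace C" and B: "B \<subseteq> {b. integrable M b}"
  shows "(\<lambda>x. \<integral>v. h x v \<partial>M) \<in> C" "integrable M (h x)"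
proof -
  have "(\<lambda>x. \<integral>v. h x v \<partial>M) \<in> C \<and> (\<forall>x. integrable M (h x))"
    using assms(1)
  proof induction
    case (tensor_add a b h)
    have i: "integrable M b" using B tensor_add by auto
    have "(\<lambda>x. (\<integral>v. b v \<partial>M) * a x + (\<integral>v. h x v \<partial>M)) \<in> C"
      using tensor_add C by (intro fun_subspace_add[OF C] fun_subspace_scale[OF C]) auto
    moreover have "(\<integral>v. a x * b v + h x v \<partial>M) = (\<integral>v. b v \<partial>M) * a x + (\<integral>v. h x v \<partial>M)" for x
      using i tensor_add by simp
    ultimately show ?case using i tensor_add by (simp add: mult.commute)
  qed (simp add: fun_subspace_zero[OF C])
  then show "(\<lambda>x. \<integral>v. h x v \<partial>M) \<in> C" "integrable M (h x)" by auto
qed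

text \<open>Both sides reduce to the sum of the numbers \<open>\<integral>v. b v \<partial>M\<close>
  times \<open>T a x\<close>, so exchanging a position derivative with the velocity integral needs
  only linearity and no dominated convergence.\<close>

lemma separable_velocity_integral_op:
  assumes "h \<in> separable C B" and C: "fun_subspace C" and T: "linear_op_on C T"
    and B: "B \<subseteq> {b. integrable M b}"
  shows "(\<integral>v. T (\<lambda>y. h y v) x \<partial>M) = T (\<lambda>y. \<integral>v. h y v \<partial>M) x"
  using assms(1)
proof induction
  case zero
  then show ?case by (simp add: linear_op_on_zero[OF T fun_subspace_zero[OF C]])
next
  case (tensor_add a b h)
  note h = separable_velocity_integral[OF tensor_add(3) C B]
  have i: "integrable M b" using B tensor_add by auto
  have "T (\<lambda>x. a x * b v + h x v) x = T a x * b v + T (\<lambda>x. h x v) x" for v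
    using linear_op_on_scale_add[OF T tensor_add(1) separable_slice_pos[OF tensor_add(3) C], of "b v"]
    by (simp add: mult.commute)
  \<comment> \<open>Only integrability in \<open>v\<close> is at stake, so the images
    \<open>T a\<close> may be placed in the trivial class \<open>UNIV\<close>.\<close>
  moreover have "integrable M (\<lambda>v. T (\<lambda>x. h x v) x)"
    using separable_velocity_integral(2)[OF separable_op_pos[OF tensor_add(3) C T, of UNIV] _ B]
    by (simp add: fun_subspace_def)
  moreover have "T (\<lambda>y. \<integral>v. a y * b v + h y v \<partial>M) x
      = (\<integral>v. b v \<partial>M) * T a x + T (\<lambda>y. \<integral>v. h y v \<partial>M) x"
    using i h linear_op_on_scale_add[OF T tensor_add(1) h(1), of "\<integral>v. b v \<partial>M"]
    by (simp add: mult.commute)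
  ultimately show ?case using i tensor_add.IH by simp
qed

lemma (in pair_sigma_finite) integrable_tensor:
  fixes a :: "'a \<Rightarrow> real" and b :: "'b \<Rightarrow> real"
  assumes "integrable M1 a" "integrable M2 b"
  shows "integrable (M1 \<Otimes>\<^sub>M M2) (\<lambda>z. a (fst z) * b (snd z))"
proof -
  have "integrable (M1 \<Otimes>\<^sub>M M2) (\<lambda>(x, y). a x * b y)"
  proof (rule Fubini_integrable)
    show "(\<lambda>(x, y). a x * b y) \<in> borel_measurable (M1 \<Otimes>\<^sub>M M2)"
      using assms[THEN borel_measurable_integrable] by measurable
  qed (use assms in \<open>auto simp: abs_mult\<close>)
  then show ?thesis by (simp add: case_prod_unfold)
qed


section \<open>Increments\<close>

context calculus_rules
begin

section \<open>Position coefficients, Fubini and orthogonal projection\<close>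

lemma posC_scale: "g \<in> posC c \<Longrightarrow> (\<lambda>x. a * g x) \<in> posC c"
  by (rule fun_subspace_scale[OF posC_subspace])

lemma posC_sum: "(\<And>i. i \<in> I \<Longrightarrow> g i \<in> posC c) \<Longrightarrow> (\<lambda>x. \<Sum>i\<in>I. g i x) \<in> posC c"
  by (rule fun_subspace_sum[OF posC_subspace])

text \<open>Velocity classes for \<open>separable\<close>. Derivatives of \<open>velD\<close>
  functions land in \<open>mean0V\<close>, so membership there records that a term contributes
  nothing to the charge; \<open>velD2\<close> permits two successive derivatives.\<close>

abbreviation "intV \<equiv> {b. integrable (velM c) b}"
abbreviation "mean0V \<equiv> {b. integrable (velM c) b \<and> (\<integral>v. b v \<partial>velM c) = 0}"
abbreviation "velD2 \<equiv> {b \<in> velD c. \<forall>l. dV c l b \<in> velD c}"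

lemma separable_cmult:
  "h \<in> separable (posC c) B \<Longrightarrow> (\<lambda>x v. a * h x v) \<in> separable (posC c) B"
  by (rule separable_mult_pos) (auto intro: posC_scale)

lemma separable_posC_mult:
  "p \<in> posC c \<Longrightarrow> h \<in> separable (posC c) B \<Longrightarrow> (\<lambda>x v. p x * h x v) \<in> separable (posC c) B"
  by (rule separable_mult_pos) (auto intro: posC_mult)

lemma separable_mean0_integral:
  assumes "h \<in> separable C mean0V"
  shows "(\<integral>v. h x v \<partial>velM c) = 0"
proof -
  have "h x \<in> mean0V"
    by (rule separable_slice_vel[OF assms]) (auto simp: fun_subspace_def)
  then show ?thesis by simp
qed

lemma separable_integrable_pair:
  assumes "h \<in> separable (posC c) intV"
  shows "integrable (posM c \<Otimes>\<^sub>M velM c) (\<lambda>z. h (fst z) (snd z))"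
proof -
  interpret pair_sigma_finite "posM c" "velM c"
    by (simp add: pair_sigma_finite_def sigma_finite_posM sigma_finite_velM)
  from assms show ?thesis
    by induction (auto intro!: Bochner_Integration.integrable_add integrable_tensor posC_integrable)
qed

text \<open>Fubini for a test function whose velocity factor is a constant \<open>k\<close>. In the
  S-step this is the column of the constant mode, and it sees only the velocity integral of the
  increment.\<close>

lemma innerXV_separable:
  assumes g: "g \<in> posC c" and h: "h \<in> separable (posC c) intV"
  shows "innerXV c (\<lambda>x v. g x * k) h = k * innerX c g (\<lambda>x. \<integral>v. h x v \<partial>velM c)"
proof -
  interpret pair_sigma_finite "posM c" "velM c"
    by (simp add: pair_sigma_finite_def sigma_finite_posM sigma_finite_velM)
  have "(\<lambda>x v. (k * g x) * h x v) \<in> separable (posC c) intV"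
    by (intro separable_posC_mult posC_scale g h)
  note i = separable_integrable_pair[OF this]
  have "innerXV c (\<lambda>x v. g x * k) h
      = (\<integral>z. (k * g (fst z)) * h (fst z) (snd z) \<partial>(posM c \<Otimes>\<^sub>M velM c))"
    by (simp add: innerXV_def mult.commute)
  also have "\<dots> = (\<integral>x. \<integral>v. (k * g x) * h x v \<partial>velM c \<partial>posM c)"
    using integral_fst'[OF i] by simp
  also have "\<dots> = k * innerX c g (\<lambda>x. \<integral>v. h x v \<partial>velM c)"
    by (simp add: innerX_def mult.assoc)
  finally show ?thesis .
qed

text \<open>Orthonormality identifies the coefficients of \<open>g\<close> as inner products; the
  projection therefore returns \<open>g\<close> because \<open>g\<close> already lies in the
  span.\<close>

lemma innerX_expansion:
  assumes B: "orthonormalX c n B" and g: "in_span n B g"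
  shows "(\<Sum>k=1..n. B k x * innerX c (B k) g) = g x"
proof -
  from g obtain a where a: "g = (\<lambda>y. \<Sum>j=1..n. a j * B j y)" by (auto simp: in_span_def)
  have "innerX c (B k) g = a k" if k: "k \<in> {1..n}" for k
  proof -
    have "integrable (posM c) (\<lambda>x. a j * (B k x * B j x))" if "j \<in> {1..n}" for j
      using B k that by (intro posC_integrable posC_scale posC_mult) (auto simp: orthonormalX_def)
    then have "innerX c (B k) g = (\<Sum>j=1..n. a j * innerX c (B k) (B j))"
      by (simp add: innerX_def a sum_distrib_left mult.left_commute)
    also have "\<dots> = (\<Sum>j=1..n. if k = j then a j else 0)"
      using B k by (intro sum.cong) (auto simp: orthonormalX_def)
    finally show ?thesis using k by simp
  qed
  then show ?thesis by (simp add: a mult.commute)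
qed

section \<open>Stochastic increments have zero velocity mean\<close>

lemma separable_dV:
  assumes "h \<in> separable C B" "B \<subseteq> velD c" "fun_subspace B" "\<And>b. b \<in> B \<Longrightarrow> dV c l b \<in> B'"
  shows "(\<lambda>x v. dV c l (h x) v) \<in> separable C B'"
  using assms(2,4) dV_linear[of l]
  by (intro separable_op_vel[OF assms(1,3)]) (auto simp: linear_op_on_def subset_iff)



lemma velD2_subspace: "fun_subspace velD2"
proof -
  have "dV c l (\<lambda>_. 0) = (\<lambda>_. 0)" for l
    by (rule linear_op_on_zero[OF dV_linear fun_subspace_zero[OF velD_subspace]])
  moreover have "dV c l (\<lambda>y. a * g y + b * h y) = (\<lambda>y. a * dV c l g y + b * dV c l h y)"
    if "g \<in> velD c" "h \<in> velD c" for l a b g h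
    using dV_linear[of l] that by (simp add: linear_op_on_def)
  ultimately show ?thesis
    using velD_subspace by (auto simp: fun_subspace_def)
qed

context
  fixes \<sigma> :: "'x \<Rightarrow> real ^ 'k::finite ^ 'd"
  assumes sigma: "\<And>l s. (\<lambda>x. \<sigma> x $ l $ s) \<in> posC c"
begin

lemma separable_column_gradV:
  assumes "\<And>l. (\<lambda>x v. dV c l (h x) v) \<in> separable (posC c) B"
  shows "(\<lambda>x v. column s (\<sigma> x) \<bullet> gradV c h x v) \<in> separable (posC c) B"
  unfolding inner_vec_def column_def gradV_def
  using assms sigma by (auto intro!: separable_sum separable_posC_mult)

text \<open>The class \<open>B\<close> stays a parameter: \<open>mean0V\<close> serves for the noise
  term of the increment, \<open>velD\<close> for the Heun predictor, which is differentiated once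
  more.\<close>

lemma separable_noise_incr:
  assumes "\<And>l. (\<lambda>x v. dV c l (h x) v) \<in> separable (posC c) B"
  shows "(\<lambda>x v. noise_incr c \<sigma> \<Delta> h x v) \<in> separable (posC c) B"
  unfolding noise_incr_def
  using separable_cmult[OF separable_column_gradV[OF assms]]
  by (auto intro!: separable_sum simp: mult.commute)

text \<open>In both schemes every term is a function of position times a velocity derivative of a
  function still in \<open>velD\<close>, hence integrates to 0 over velocity.\<close>

lemma separable_stoch_incr:
  assumes h: "h \<in> separable (posC c) velD2"
  shows "stoch_incr \<theta> c \<sigma> \<tau> \<Delta> h \<in> separable (posC c) mean0V"
proof -
  have h1: "h \<in> separable (posC c) (velD c)" by (rule separable_mono[OF h]) auto
  have dh: "(\<lambda>x v. dV c l (h x) v) \<in> separable (posC c) (velD c)" for l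
    by (rule separable_dV[OF h _ velD2_subspace]) auto
  have dm: "(\<lambda>x v. dV c l (g x) v) \<in> separable (posC c) mean0V"
    if "g \<in> separable (posC c) (velD c)" for g l
    by (rule separable_dV[OF that _ velD_subspace]) (auto simp: dV_integrable integral_dV)
  show ?thesis
  proof (cases \<theta>)
    case EM
    \<comment> \<open>The diffusion matrix depends on \<open>x\<close> only, so it keeps the
      gradient in \<open>velD\<close> and the outer divergence is again a sum of velocity
      derivatives.\<close>
    have "(\<lambda>x. (\<sigma> x ** transpose (\<sigma> x)) $ l $ l') \<in> posC c" for l l'
      unfolding matrix_matrix_mult_def transpose_def
      by (auto intro!: posC_sum posC_mult sigma)
    then have "(\<lambda>x v. ((\<sigma> x ** transpose (\<sigma> x)) *v gradV c h x v) $ l) \<in> separable (posC c) (velD c)" for l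
      unfolding matrix_vector_mult_def gradV_def
      using dh by (auto intro!: separable_sum separable_posC_mult)
    from dm[OF this]
    have "(\<lambda>x v. divV c (\<lambda>y u. (\<sigma> y ** transpose (\<sigma> y)) *v gradV c h y u) x v) \<in> separable (posC c) mean0V"
      unfolding divV_def by (intro separable_sum)
    from separable_add[OF separable_cmult[OF separable_noise_incr[OF dm[OF h1]], of "-1" \<Delta>]
        separable_cmult[OF this, of "\<tau> / 2"]]
    show ?thesis unfolding EM by (simp add: stoch_incr.simps[abs_def])
  next
    case Heun
    \<comment> \<open>The predictor uses up one of the two derivatives available from
      \<open>velD2\<close> and can still be differentiated once.\<close>
    have ft: "(\<lambda>x v. h x v - noise_incr c \<sigma> \<Delta> h x v) \<in> separable (posC c) (velD c)"
      using separable_add[OF h1 separable_cmult[OF separable_noise_incr[OF dh], of "-1" \<Delta>]] by simp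
    have "(\<lambda>x v. - (1 / 2) * (\<Sum>s\<in>UNIV. \<Delta> s * (column s (\<sigma> x) \<bullet> gradV c h x v
        + column s (\<sigma> x) \<bullet> gradV c (\<lambda>y w. h y w - noise_incr c \<sigma> \<Delta> h y w) x v)))
        \<in> separable (posC c) mean0V"
      by (intro separable_cmult separable_sum separable_add separable_column_gradV dm h1 ft)
    then show ?thesis unfolding Heun by (simp add: stoch_incr.simps[abs_def] Let_def mult.commute)
  qed
qed

end

section \<open>Electric field, velocity moments and the drift increment\<close>

lemma electric_field_posC:
  assumes "electric_field c f E"
  shows "(\<lambda>x. E x $ l) \<in> posC c"
proof -
  from assms obtain u where "u \<in> posD c" "\<And>x. E x = - gradX c u x"
    by (auto simp: electric_field_def)
  then show ?thesis
    using posC_scale[OF dX_posC, of u "-1" l] by (simp add: gradX_def)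
qed

text \<open>The product is dominated by the sum of the two squares, by the arithmetic-geometric mean
  inequality with its factor 2 dropped.\<close>

lemma L2W_product_integrable:
  assumes "g \<in> L2W c w" "h \<in> L2W c w" and w: "w \<in> borel_measurable (velM c)" "\<And>v. 0 < w v"
  shows "integrable (velM c) (\<lambda>v. w v * g v * h v)"
proof (rule Bochner_Integration.integrable_bound)
  show "integrable (velM c) (\<lambda>v. w v * (g v)\<^sup>2 + w v * (h v)\<^sup>2)"
    using assms by (auto simp: L2W_def)
  show "(\<lambda>v. w v * g v * h v) \<in> borel_measurable (velM c)"
    using assms by (auto simp: L2W_def)
  have "\<bar>g v * h v\<bar> \<le> (g v)\<^sup>2 + (h v)\<^sup>2" for v
  proof -
    have "2 * \<bar>g v * h v\<bar> \<le> (g v)\<^sup>2 + (h v)\<^sup>2"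
      using sum_squares_bound[of "\<bar>g v\<bar>" "\<bar>h v\<bar>"] by (simp add: abs_mult mult.assoc)
    then show ?thesis using abs_ge_zero[of "g v * h v"] by linarith
  qed
  then have "w v * \<bar>g v * h v\<bar> \<le> w v * ((g v)\<^sup>2 + (h v)\<^sup>2)" for v
    using w(2)[of v] by (intro mult_left_mono) auto
  then show "AE v in velM c. norm (w v * g v * h v) \<le> norm (w v * (g v)\<^sup>2 + w v * (h v)\<^sup>2)"
    using w(2) by (auto simp: abs_mult distrib_left less_imp_le mult.assoc abs_of_pos)
qed

text \<open>Velocity factors with finite zeroth and first moments, as required for charge and
  current.\<close>

abbreviation "momV \<equiv> {b. integrable (velM c) b \<and> (\<forall>l. integrable (velM c) (\<lambda>v. vel c v $ l * b v))}"

text \<open>The current is a linear combination of the position factors of \<open>f\<close>, so it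
  inherits any subspace \<open>C\<close> containing them. The one-step argument takes a
  \<open>C\<close> that also controls derivatives.\<close>

lemma current_density_component:
  assumes f: "f \<in> separable C momV" and C: "fun_subspace C"
  shows "current_density c f x $ l = (\<integral>v. vel c v $ l * f x v \<partial>velM c)"
    "(\<lambda>y. current_density c f y $ l) \<in> C"
proof -
  have s: "(\<lambda>x v. vel c v $ l * f x v) \<in> separable C intV" for l
    by (rule separable_mult_vel[OF f]) auto
  have i: "integrable (velM c) (\<lambda>v. vel c v $ l * f x v)" for l x
    by (rule separable_velocity_integral(2)[OF s C]) auto
  \<comment> \<open>Integrability of the vector-valued integrand is assembled from its coordinates;
    only then may the bounded linear coordinate map be pulled out of the integral.\<close>
  have "integrable (velM c) (\<lambda>v. \<Sum>l\<in>UNIV. (vel c v $ l * f x v) *\<^sub>R axis l (1::real))" for x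
    using i by auto
  moreover have "(\<Sum>l\<in>UNIV. (vel c v $ l * f x v) *\<^sub>R axis l (1::real)) = f x v *\<^sub>R vel c v" for x v
    by (simp add: vec_eq_iff sum_component axis_def if_distrib mult.commute cong: if_cong)
  ultimately have "integrable (velM c) (\<lambda>v. f x v *\<^sub>R vel c v)" for x by simp
  from integral_bounded_linear[OF bounded_linear_vec_nth this]
  show e: "current_density c f x $ l = (\<integral>v. vel c v $ l * f x v \<partial>velM c)" for x
    by (simp add: current_density_def mult.commute)
  show "(\<lambda>y. current_density c f y $ l) \<in> C"
    unfolding e by (rule separable_velocity_integral(1)[OF s C]) auto
qed

text \<open>The field term \<open>?B\<close> is a position coefficient times velocity derivatives
  and has zero mean. In the transport term \<open>?A\<close> the derivative in \<open>x\<close>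
  passes through the velocity integral, which produces the divergence of the current.\<close>

lemma drift_incr_mean:
  assumes f: "f \<in> separable (posD c) momV" "f \<in> separable (posC c) (velD c)"
    and E: "\<And>l. (\<lambda>x. E x $ l) \<in> posC c"
  shows "drift_incr c E f \<in> separable (posC c) intV"
    "(\<integral>v. drift_incr c E f x v \<partial>velM c) = - divX c (current_density c f) x"
proof -
  let ?A = "\<lambda>l x v. vel c v $ l * dX c l (\<lambda>y. f y v) x"
  let ?B = "\<lambda>x v. \<Sum>l\<in>UNIV. (- E x $ l) * dV c l (f x) v"
  have D: "drift_incr c E f = (\<lambda>x v. - 1 * (\<Sum>l\<in>UNIV. ?A l x v) + ?B x v)"
    by (simp add: drift_incr_def fun_eq_iff inner_vec_def gradX2_def gradX_def gradV_def sum_negf)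
  have A: "?A l \<in> separable (posC c) intV" for l
    by (rule separable_mult_vel[OF separable_op_pos[OF f(1) posD_subspace dX_linear dX_posC]]) auto
  have "(\<lambda>x. - E x $ l) \<in> posC c" for l using posC_scale[OF E, of "-1"] by simp
  moreover have "(\<lambda>x v. dV c l (f x) v) \<in> separable (posC c) mean0V" for l
    by (rule separable_dV[OF f(2) _ velD_subspace]) (auto simp: dV_integrable integral_dV)
  ultimately have B: "?B \<in> separable (posC c) mean0V"
    by (intro separable_sum separable_posC_mult)
  have B': "?B \<in> separable (posC c) intV" by (rule separable_mono[OF B]) auto
  show "drift_incr c E f \<in> separable (posC c) intV"
    unfolding D by (intro separable_add separable_cmult separable_sum A B')
  have vf: "(\<lambda>x v. vel c v $ l * f x v) \<in> separable (posD c) intV" for l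
    by (rule separable_mult_vel[OF f(1)]) auto
  have AJ: "(\<integral>v. ?A l x v \<partial>velM c) = dX c l (\<lambda>y. current_density c f y $ l) x" for l
  proof -
    \<comment> \<open>At fixed \<open>v\<close> the velocity coordinate is a scalar; scaling is the
      case of a zero second summand in \<open>linear_op_on_scale_add\<close>.\<close>
    have "dX c l (\<lambda>y. vel c v $ l * f y v) = (\<lambda>x. ?A l x v)" for v
      using linear_op_on_scale_add[OF dX_linear separable_slice_pos[OF f(1) posD_subspace]
          fun_subspace_zero[OF posD_subspace]] linear_op_on_zero[OF dX_linear fun_subspace_zero[OF posD_subspace]]
      by simp
    then show ?thesis
      using separable_velocity_integral_op[OF vf posD_subspace dX_linear, of "velM c" l l x]
      by (simp add: current_density_component(1)[OF f(1) posD_subspace])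
  qed
  have iA: "integrable (velM c) (?A l x)" for l
    by (rule separable_velocity_integral(2)[OF A posC_subspace]) auto
  have iB: "integrable (velM c) (?B x)"
    by (rule separable_velocity_integral(2)[OF B' posC_subspace]) auto
  have "(\<integral>v. drift_incr c E f x v \<partial>velM c)
      = - 1 * (\<Sum>l\<in>UNIV. \<integral>v. ?A l x v \<partial>velM c) + (\<integral>v. ?B x v \<partial>velM c)"
    unfolding D using iA iB by (subst Bochner_Integration.integral_add) auto
  then show "(\<integral>v. drift_incr c E f x v \<partial>velM c) = - divX c (current_density c f) x"
    using separable_mean0_integral[OF B, of x] by (simp add: AJ divX_def)
qed


section \<open>Charge balance of one step\<close>

lemma aug_density_eq:
  assumes "projection_identities c w r z A"
  shows "aug_density c w r z A = lr_density w r z"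
proof (intro ext)
  fix x v
  let ?p = "\<lambda>i k. innerX c (aX A k) (mX z i)" and ?q = "\<lambda>j l. innerW c w (mV z j) (aV A l)"
  have "(\<Sum>k=1..rX A. \<Sum>l=1..rV A. aX A k x * aug_core c w r z A k l * aV A l v)
     = (\<Sum>k=1..rX A. \<Sum>l=1..rV A. \<Sum>i=1..r. \<Sum>j=1..r. (?p i k * aX A k x) * mS z i j * (?q j l * aV A l v))"
    by (simp add: aug_core_def sum_distrib_left sum_distrib_right algebra_simps)
  \<comment> \<open>Adjacent swaps move the sums over \<open>i\<close> and \<open>j\<close> outside,
    so that the sums over \<open>k\<close> and \<open>l\<close> factor into the two projection
    identities.\<close>
  also have "\<dots> = (\<Sum>k=1..rX A. \<Sum>i=1..r. \<Sum>l=1..rV A. \<Sum>j=1..r. (?p i k * aX A k x) * mS z i j * (?q j l * aV A l v))"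
    by (intro sum.cong refl sum.swap)
  also have "\<dots> = (\<Sum>i=1..r. \<Sum>k=1..rX A. \<Sum>l=1..rV A. \<Sum>j=1..r. (?p i k * aX A k x) * mS z i j * (?q j l * aV A l v))"
    by (rule sum.swap)
  also have "\<dots> = (\<Sum>i=1..r. \<Sum>k=1..rX A. \<Sum>j=1..r. \<Sum>l=1..rV A. (?p i k * aX A k x) * mS z i j * (?q j l * aV A l v))"
    by (intro sum.cong refl sum.swap)
  also have "\<dots> = (\<Sum>i=1..r. \<Sum>j=1..r. \<Sum>k=1..rX A. \<Sum>l=1..rV A. (?p i k * aX A k x) * mS z i j * (?q j l * aV A l v))"
    by (intro sum.cong refl sum.swap)
  also have "\<dots> = (\<Sum>i=1..r. \<Sum>j=1..r.
      (\<Sum>k=1..rX A. ?p i k * aX A k x) * mS z i j * (\<Sum>l=1..rV A. ?q j l * aV A l v))"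
    by (intro sum.cong refl) (simp only: sum_distrib_right, simp only: sum_distrib_left)
  also have "\<dots> = (\<Sum>i=1..r. \<Sum>j=1..r. mX z i x * mS z i j * mV z j v)"
    using assms by (intro sum.cong refl) (auto simp: projection_identities_def)
  finally show "aug_density c w r z A x v = lr_density w r z x v"
    by (simp add: aug_density_def lr_density_def)
qed

text \<open>Since \<open>aV A a\<close> is itself an old mode, orthonormality of the old velocity
  modes collapses the sum over \<open>j\<close>; the position projection identity handles the
  rest.\<close>

lemma aug_core_column:
  assumes "projection_identities c w r z A" "orthonormalW c w r (mV z)"
    and a: "a \<in> {1..r}" "aV A a = mV z a"
  shows "(\<Sum>k=1..rX A. aX A k x * aug_core c w r z A k a) = (\<Sum>i=1..r. mX z i x * mS z i a)"
proof -
  have "aug_core c w r z A k a = (\<Sum>i=1..r. innerX c (aX A k) (mX z i) * mS z i a)" for k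
  proof -
    have "aug_core c w r z A k a
        = (\<Sum>i=1..r. \<Sum>j=1..r. if j = a then innerX c (aX A k) (mX z i) * mS z i j else 0)"
      unfolding aug_core_def using assms by (intro sum.cong refl) (auto simp: orthonormalW_def)
    then show ?thesis using a by simp
  qed
  then have "(\<Sum>k=1..rX A. aX A k x * aug_core c w r z A k a)
      = (\<Sum>k=1..rX A. \<Sum>i=1..r. (innerX c (aX A k) (mX z i) * aX A k x) * mS z i a)"
    by (simp add: sum_distrib_left algebra_simps)
  also have "\<dots> = (\<Sum>i=1..r. (\<Sum>k=1..rX A. innerX c (aX A k) (mX z i) * aX A k x) * mS z i a)"
    by (subst sum.swap) (simp add: sum_distrib_right)
  also have "\<dots> = (\<Sum>i=1..r. mX z i x * mS z i a)"
    using assms(1) by (intro sum.cong) (auto simp: projection_identities_def)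
  finally show ?thesis .
qed

text \<open>The final QR factor \<open>R\<close> cancels against \<open>mX z'\<close>, and the
  middle factor is block diagonal. A conserved column thus sees only \<open>Xc\<close> and
  \<open>Sc\<close>, whose product is the untruncated column.\<close>

lemma conservative_truncation_column:
  assumes "conservative_truncation c m r U A T z'" and a: "a \<in> {1..m}" and "m \<le> r"
  shows "(\<Sum>i=1..r. mX z' i x * mS z' i a) = (\<Sum>k=1..rX A. aX A k x * T k a)"
proof -
  \<comment> \<open>Here \<open>Q\<close> is the matrix of left singular vectors, called
    \<open>P\<close> in the definition of the truncation.\<close>
  obtain Xc Sc Xr Q R s where
    K: "qr_factorization c m (\<lambda>l x. \<Sum>k=1..rX A. aX A k x * T k l) Xc Sc" and
    Y: "qr_factorization c r
      (\<lambda>a x. if a \<le> m then Xc a x else \<Sum>b=1..rV A - m. Xr b x * Q b (a - m)) (mX z') R" and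
    S: "\<forall>i\<in>{1..r}. \<forall>j\<in>{1..r}. mS z' i j =
      (\<Sum>k=1..r. R i k * (if k \<le> m \<and> j \<le> m then Sc k j else if k = j then s (k - m) else 0))"
    using assms(1) unfolding conservative_truncation_def Let_def by blast
  have X: "(\<Sum>i=1..r. mX z' i x * R i k) = Xc k x" if "k \<in> {1..m}" for k
  proof -
    have "k \<in> {1..r}" using that \<open>m \<le> r\<close> by simp
    with Y have "(\<lambda>x. if k \<le> m then Xc k x else \<Sum>b=1..rV A - m. Xr b x * Q b (k - m))
        = (\<lambda>x. \<Sum>i=1..r. mX z' i x * R i k)"
      unfolding qr_factorization_def by blast
    from fun_cong[OF this, of x] show ?thesis using that by simp
  qed
  have "mS z' i a = (\<Sum>k=1..m. R i k * Sc k a)" if "i \<in> {1..r}" for i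
  proof -
    have "mS z' i a = (\<Sum>k=1..r. R i k * (if k \<le> m \<and> a \<le> m then Sc k a else if k = a then s (k - m) else 0))"
      using S that a \<open>m \<le> r\<close> by auto
    \<comment> \<open>For \<open>k > m\<close> both conditions fail, since \<open>a \<le> m\<close>
      rules out \<open>k = a\<close>; these summands vanish.\<close>
    also have "\<dots> = (\<Sum>k=1..m. R i k * Sc k a)"
      using a \<open>m \<le> r\<close> by (intro sum.mono_neutral_cong_right) auto
    finally show ?thesis .
  qed
  then have "(\<Sum>i=1..r. mX z' i x * mS z' i a) = (\<Sum>i=1..r. \<Sum>k=1..m. (mX z' i x * R i k) * Sc k a)"
    by (simp add: sum_distrib_left mult.assoc)
  also have "\<dots> = (\<Sum>k=1..m. (\<Sum>i=1..r. mX z' i x * R i k) * Sc k a)"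
    by (subst sum.swap) (simp add: sum_distrib_right)
  also have "\<dots> = (\<Sum>k=1..m. Xc k x * Sc k a)" using X by simp
  also have "\<dots> = (\<Sum>k=1..rX A. aX A k x * T k a)"
    using K a by (auto simp: qr_factorization_def fun_eq_iff)
  finally show ?thesis .
qed

section \<open>Charge density as the coefficient of the constant mode\<close>

text \<open>Orthogonality to the constant mode says that all other modes have weighted integral 0,
  while the constant mode itself integrates to \<open>normW c w (\<lambda>_. 1)\<close>.\<close>

lemma lowrank_constant_mode:
  assumes w: "velocity_weight c w" and m: "1 \<le> m" "m \<le> r"
    and U: "\<And>v. U 1 v = 1 / normW c w (\<lambda>_. 1)" and z: "lowrank_state c w m r U z"
  shows lowrank_mode_integrable: "j \<in> {1..r} \<Longrightarrow> (\<lambda>v. w v * mV z j v) \<in> momV"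
    and normW_one_nonzero: "normW c w (\<lambda>_. 1) \<noteq> 0"
    and charge_density_lowrank: "charge_density c (lr_density w r z) x
      = normW c w (\<lambda>_. 1) * (\<Sum>i=1..r. mX z i x * mS z i 1)"
proof -
  let ?k = "normW c w (\<lambda>_. 1)"
  have V: "orthonormalW c w r (mV z)" and V1: "mV z 1 = (\<lambda>_. 1 / ?k)"
    using z m U by (auto simp: lowrank_state_def fun_eq_iff)
  have w': "w \<in> borel_measurable (velM c)" "\<And>v. 0 < w v" "(\<lambda>_. 1) \<in> L2W c w"
    "\<And>l. (\<lambda>v. vel c v $ l) \<in> L2W c w"
    using w by (auto simp: velocity_weight_def)
  show i: "(\<lambda>v. w v * mV z j v) \<in> momV" if "j \<in> {1..r}" for j
  proof -
    have "mV z j \<in> L2W c w" using V that by (auto simp: orthonormalW_def)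
    then show ?thesis
      using L2W_product_integrable[OF _ w'(3) w'(1,2), of "mV z j"]
        L2W_product_integrable[OF _ w'(4) w'(1,2), of "mV z j"]
      by (simp add: mult.commute mult.left_commute)
  qed
  have o: "innerW c w (mV z 1) (mV z j) = (if 1 = j then 1 else 0)" if "j \<in> {1..r}" for j
    using V that m unfolding orthonormalW_def by auto
  \<comment> \<open>If the norm were 0, division by zero would make the first mode the zero
    function, against its unit norm.\<close>
  show k: "?k \<noteq> 0"
  proof
    assume "?k = 0"
    then show False using o[of 1] m by (simp add: V1 innerW_def del: One_nat_def)
  qed
  have e: "(\<integral>v. w v * mV z j v \<partial>velM c) = (if j = 1 then ?k else 0)" if "j \<in> {1..r}" for j
  proof -
    have "innerW c w (mV z 1) (mV z j) = (\<integral>v. (w v * mV z j v) / ?k \<partial>velM c)"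
      unfolding innerW_def V1 by (rule Bochner_Integration.integral_cong) auto
    also have "\<dots> = (\<integral>v. w v * mV z j v \<partial>velM c) / ?k" by simp
    finally show ?thesis using o[OF that] k by (auto simp: field_simps split: if_splits)
  qed
  have "charge_density c (lr_density w r z) x
      = (\<integral>v. (\<Sum>i=1..r. \<Sum>j=1..r. (mX z i x * mS z i j) * (w v * mV z j v)) \<partial>velM c)"
    by (simp add: charge_density_def lr_density_def sum_distrib_left algebra_simps)
  also have "\<dots> = (\<Sum>i=1..r. \<Sum>j=1..r. (mX z i x * mS z i j) * (\<integral>v. w v * mV z j v \<partial>velM c))"
  proof -
    have I: "integrable (velM c) (\<lambda>v. (mX z i x * mS z i j) * (w v * mV z j v))" if "j \<in> {1..r}" for i j
      using i[OF that] by simp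
    have "(\<integral>v. (\<Sum>i=1..r. \<Sum>j=1..r. (mX z i x * mS z i j) * (w v * mV z j v)) \<partial>velM c)
        = (\<Sum>i=1..r. \<integral>v. (\<Sum>j=1..r. (mX z i x * mS z i j) * (w v * mV z j v)) \<partial>velM c)"
      by (intro Bochner_Integration.integral_sum Bochner_Integration.integrable_sum I)
    also have "\<dots> = (\<Sum>i=1..r. \<Sum>j=1..r. \<integral>v. (mX z i x * mS z i j) * (w v * mV z j v) \<partial>velM c)"
      by (intro sum.cong refl Bochner_Integration.integral_sum I)
    finally show ?thesis by simp
  qed
  also have "\<dots> = (\<Sum>i=1..r. \<Sum>j=1..r. if j = 1 then ?k * (mX z i x * mS z i j) else 0)"
    using e by (intro sum.cong refl) auto
  also have "\<dots> = ?k * (\<Sum>i=1..r. mX z i x * mS z i 1)"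
    using m by (simp add: sum_distrib_left)
  finally show "charge_density c (lr_density w r z) x = ?k * (\<Sum>i=1..r. mX z i x * mS z i 1)" .
qed

text \<open>The increments \<open>\<Delta>\<close> are arbitrary real numbers here, so the balance
  is a pathwise identity.\<close>

lemma bug_step_continuity:
  fixes \<sigma> :: "'x \<Rightarrow> real ^ 'k::finite ^ 'd"
  assumes sigma: "\<And>l s. (\<lambda>x. \<sigma> x $ l $ s) \<in> posC c"
    and w: "velocity_weight c w" and m: "1 \<le> m" "m \<le> r"
    and U: "\<And>v. U 1 v = 1 / normW c w (\<lambda>_. 1)"
    and z: "lowrank_state c w m r U z" "lowrank_state c w m r U z'"
    and reg: "regular_state c w r z"
    and step: "bug_step \<theta> c w \<sigma> m r U \<tau> \<Delta> z E A z'"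
    and proj: "projection_identities c w r z A"
  defines "f \<equiv> lr_density w r z"
  shows "charge_density c (lr_density w r z') x
      = charge_density c f x - \<tau> * divX c (current_density c f) x"
    and "total_mass c (lr_density w r z') = total_mass c f"
proof -
  let ?k = "normW c w (\<lambda>_. 1)" and ?J = "current_density c f"
  note mode = lowrank_constant_mode[OF w m U z(1)]
  \<comment> \<open>Once the augmented density is identified with \<open>f\<close>, the S-step
    increments are those of \<open>f\<close> itself. \<open>E'\<close> is then a field of
    \<open>f\<close> too, but it is not claimed to equal \<open>E\<close>.\<close>
  obtain E' where E': "electric_field c f E'"
    and aug: "basis_augmentation c w m r U \<tau> (drift_incr c E f) (stoch_incr \<theta> c \<sigma> \<tau> \<Delta> f) z A"
    and trunc: "conservative_truncation c m r U A
          (S_next c w r \<tau> (drift_incr c E' f) (stoch_incr \<theta> c \<sigma> \<tau> \<Delta> f) z A) z'"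
    using step unfolding bug_step_def aug_density_eq[OF proj] f_def by auto
  let ?D = "drift_incr c E' f" and ?G = "stoch_incr \<theta> c \<sigma> \<tau> \<Delta> f"
  have X: "orthonormalX c (rX A) (aX A)"
    and XdX: "\<And>i l. i \<in> {1..r} \<Longrightarrow> in_span (rX A) (aX A) (dX c l (mX z i))"
    and aV1: "aV A 1 = U 1"
    using aug m unfolding basis_augmentation_def by auto
  have V1: "mV z 1 = U 1" using z(1) m by (auto simp: lowrank_state_def)
  \<comment> \<open>Functions whose derivatives lie in the augmented position space. The old modes
    belong to \<open>C\<close> by the augmentation, and since \<open>C\<close> is a subspace the
    components of the current do as well.\<close>
  define C where "C = {u \<in> posD c. \<forall>l. in_span (rX A) (aX A) (dX c l u)}"
  have C: "fun_subspace C"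
  proof -
    have "dX c l (\<lambda>_. 0) = (\<lambda>_. 0)" for l
      by (rule linear_op_on_zero[OF dX_linear fun_subspace_zero[OF posD_subspace]])
    moreover have "dX c l (\<lambda>y. a * g y + b * h y) = (\<lambda>y. a * dX c l g y + b * dX c l h y)"
      if "g \<in> posD c" "h \<in> posD c" for l a b g h
      using dX_linear[of l] that by (simp add: linear_op_on_def)
    ultimately show ?thesis
      using posD_subspace in_span_subspace[of "rX A" "aX A"] by (auto simp: C_def fun_subspace_def)
  qed
  \<comment> \<open>The same density is recorded with several classes: \<open>C\<close> and
    \<open>momV\<close> for the current, \<open>velD2\<close> for the stochastic increment,
    \<open>velD\<close> for the field term.\<close>
  have fC: "f \<in> separable C momV"
    unfolding f_def using reg XdX mode(1)
    by (intro separable_lr_density[OF C]) (auto simp: C_def regular_state_def)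
  have f1: "f \<in> separable (posD c) momV"
    by (rule separable_mono[OF fC]) (auto simp: C_def)
  have f2: "f \<in> separable (posC c) velD2"
    unfolding f_def using reg posD_posC
    by (intro separable_lr_density[OF posC_subspace]) (auto simp: regular_state_def)
  have f3: "f \<in> separable (posC c) (velD c)" by (rule separable_mono[OF f2]) auto
  note D = drift_incr_mean[OF f1 f3 electric_field_posC[OF E']]
  have G0: "?G \<in> separable (posC c) mean0V" by (rule separable_stoch_incr[OF sigma f2])
  have G: "?G \<in> separable (posC c) intV" by (rule separable_mono[OF G0]) auto
  have JC: "(\<lambda>y. ?J y $ l) \<in> C" for l by (rule current_density_component(2)[OF fC C])
  have dJ: "dX c l (\<lambda>y. ?J y $ l) \<in> {g. in_span (rX A) (aX A) g}" for l
    using JC[of l] by (simp add: C_def)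
  have "(\<lambda>x. - 1 * divX c ?J x) \<in> {g. in_span (rX A) (aX A) g}"
    unfolding divX_def by (intro fun_subspace_scale fun_subspace_sum in_span_subspace dJ)
  then have span: "in_span (rX A) (aX A) (\<lambda>x. - 1 * divX c ?J x)" by simp
  \<comment> \<open>Testing with the constant mode \<open>1 / ?k\<close> leaves the velocity
    integrals of the increments: minus the divergence of the current from the drift and 0 from the
    noise.\<close>
  have S: "S_next c w r \<tau> ?D ?G z A k 1
      = aug_core c w r z A k 1 + \<tau> / ?k * innerX c (aX A k) (\<lambda>x. - 1 * divX c ?J x)"
    if "k \<in> {1..rX A}" for k
  proof -
    have g: "aX A k \<in> posC c" using X that by (auto simp: orthonormalX_def)
    have "aV A 1 = (\<lambda>_. 1 / ?k)" using aV1 U by auto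
    then show ?thesis
      unfolding S_next_def
      by (simp add: innerXV_separable[OF g D(1), of "1 / ?k", simplified]
          innerXV_separable[OF g G, of "1 / ?k", simplified] D(2) separable_mean0_integral[OF G0])
         (simp add: innerX_def)
  qed
  have "(\<Sum>i=1..r. mX z' i x * mS z' i 1)
      = (\<Sum>k=1..rX A. aX A k x * S_next c w r \<tau> ?D ?G z A k 1)" for x
    using m by (intro conservative_truncation_column[OF trunc]) auto
  also have "(\<Sum>k=1..rX A. aX A k x * S_next c w r \<tau> ?D ?G z A k 1)
      = (\<Sum>k=1..rX A. aX A k x * aug_core c w r z A k 1)
      + \<tau> / ?k * (\<Sum>k=1..rX A. aX A k x * innerX c (aX A k) (\<lambda>x. - 1 * divX c ?J x))" for x
    unfolding sum_distrib_left sum.distrib[symmetric]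
    by (intro sum.cong refl) (simp only: S, simp add: algebra_simps)
  also have "(\<Sum>k=1..rX A. aX A k x * aug_core c w r z A k 1) = (\<Sum>i=1..r. mX z i x * mS z i 1)" for x
    using z(1) m by (intro aug_core_column[OF proj]) (auto simp: lowrank_state_def aV1 V1 simp del: One_nat_def)
  \<comment> \<open>Augmentation by the derivatives of the modes pays off here: the projection of
    the divergence loses nothing.\<close>
  also have "(\<Sum>k=1..rX A. aX A k x * innerX c (aX A k) (\<lambda>x. - 1 * divX c ?J x)) = - 1 * divX c ?J x" for x
    by (rule innerX_expansion[OF X span])
  finally have col: "(\<Sum>i=1..r. mX z' i x * mS z' i 1)
      = (\<Sum>i=1..r. mX z i x * mS z i 1) + \<tau> / ?k * (- 1 * divX c ?J x)" for x .
  show \<rho>: "charge_density c (lr_density w r z') x = charge_density c f x - \<tau> * divX c ?J x" for x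
    unfolding f_def lowrank_constant_mode(3)[OF w m U z(2)] mode(3) col[unfolded f_def]
    using mode(2) by (simp add: field_simps)
  have J: "(\<lambda>y. ?J y $ l) \<in> posD c" for l using JC[of l] by (simp add: C_def)
  have "integrable (posM c) (\<lambda>x. dX c l (\<lambda>y. ?J y $ l) x)" for l
    by (rule posC_integrable[OF dX_posC[OF J]])
  \<comment> \<open>Periodicity makes the divergence integrate to 0, so integrating the local
    balance gives conservation of mass.\<close>
  then have "integrable (posM c) (divX c ?J)" "(\<integral>x. divX c ?J x \<partial>posM c) = 0"
    unfolding divX_def[abs_def] by (simp_all add: integral_dX[OF J])
  moreover have "(\<lambda>x. charge_density c f x) \<in> posC c"
    unfolding charge_density_def f_def[symmetric]
    by (rule separable_velocity_integral(1)[OF separable_mono[OF f1 posD_posC order.refl] posC_subspace]) auto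
  ultimately show "total_mass c (lr_density w r z') = total_mass c f"
    by (simp add: total_mass_def \<rho> posC_integrable)
qed

end

section \<open>From one path and one step to almost sure statements\<close>

theorem theorem4p1:
  fixes c :: "('x, 'v, 'd::finite) calculus"
    and P :: "'w measure" and F :: "real \<Rightarrow> 'w measure"
    and \<beta> :: "'k::finite \<Rightarrow> real \<Rightarrow> 'w \<Rightarrow> real"
    and \<sigma> :: "'x \<Rightarrow> real ^ 'k ^ 'd"
    and f\<^sub>0 :: "'v \<Rightarrow> real"
    and U :: "nat \<Rightarrow> 'v \<Rightarrow> real"
    and m r N :: nat and \<tau> :: real and \<theta> :: integrator
    and Z :: "nat \<Rightarrow> 'w \<Rightarrow> ('x, 'v) lowrank"
    and E :: "nat \<Rightarrow> 'w \<Rightarrow> 'x \<Rightarrow> real ^ 'd"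
    and A :: "nat \<Rightarrow> 'w \<Rightarrow> ('x, 'v) augmented"
    and f :: "nat \<Rightarrow> 'w \<Rightarrow> 'x \<Rightarrow> 'v \<Rightarrow> real"
  assumes calculus: "calculus_rules c"
    and probability_space: "complete_filtered_prob_space P F"
    and brownian: "independent_brownian_motions P F \<beta>"
    and sigma: "\<And>l s. (\<lambda>x. \<sigma> x $ l $ s) \<in> posC c"
    and weight: "velocity_weight c f\<^sub>0"
    and time_step: "0 < \<tau>"
    and modes: "1 \<le> m" "m \<le> r"
    and constant_mode: "\<And>v. U 1 v = 1 / normW c f\<^sub>0 (\<lambda>_. 1)"
    and states: "\<And>n. n \<le> N \<Longrightarrow> AE \<omega> in P. lowrank_state c f\<^sub>0 m r U (Z n \<omega>)"
    and regular: "\<And>n. n < N \<Longrightarrow> AE \<omega> in P. regular_state c f\<^sub>0 r (Z n \<omega>)"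
    and step: "\<And>n. n < N \<Longrightarrow> AE \<omega> in P.
      bug_step \<theta> c f\<^sub>0 \<sigma> m r U \<tau> (brownian_increment \<beta> \<tau> n \<omega>)
        (Z n \<omega>) (E n \<omega>) (A (n + 1) \<omega>) (Z (n + 1) \<omega>)"
    and projection: "\<And>n. n < N \<Longrightarrow> AE \<omega> in P. projection_identities c f\<^sub>0 r (Z n \<omega>) (A (n + 1) \<omega>)"
    and density: "\<And>n \<omega>. f n \<omega> = lr_density f\<^sub>0 r (Z n \<omega>)"
  shows "(\<forall>n<N. AE \<omega> in P. \<forall>x.
            (charge_density c (f (n + 1) \<omega>) x - charge_density c (f n \<omega>) x) / \<tau>
            + divX c (current_density c (f n \<omega>)) x = 0) \<and>
         (\<forall>n\<le>N. AE \<omega> in P. total_mass c (f n \<omega>) = total_mass c (f 0 \<omega>))"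
proof -
  interpret calculus_rules c by (rule calculus)
  have s: "AE \<omega> in P.
      (\<forall>x. charge_density c (f (n + 1) \<omega>) x
         = charge_density c (f n \<omega>) x - \<tau> * divX c (current_density c (f n \<omega>)) x) \<and>
      total_mass c (f (n + 1) \<omega>) = total_mass c (f n \<omega>)" if "n < N" for n
  proof -
    \<comment> \<open>Finitely many almost sure events are intersected, and the pathwise balance
      applies at each outcome of the intersection.\<close>
    have "AE \<omega> in P. lowrank_state c f\<^sub>0 m r U (Z n \<omega>)"
      "AE \<omega> in P. lowrank_state c f\<^sub>0 m r U (Z (n + 1) \<omega>)"
      using states that by auto
    with step[OF that] regular[OF that] projection[OF that] show ?thesis
      unfolding density
      by eventually_elim (use bug_step_continuity[where \<sigma> = \<sigma> and U = U, OF sigma weight modes constant_mode] in blast)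
  qed
  have "AE \<omega> in P. total_mass c (f n \<omega>) = total_mass c (f 0 \<omega>)" if "n \<le> N" for n
    using that
  proof (induction n)
    case (Suc n)
    then have "AE \<omega> in P. total_mass c (f n \<omega>) = total_mass c (f 0 \<omega>)" "n < N" by auto
    with s[of n] show ?case by (auto elim!: AE_mp)
  qed simp
  moreover have "AE \<omega> in P. \<forall>x.
      (charge_density c (f (n + 1) \<omega>) x - charge_density c (f n \<omega>) x) / \<tau>
      + divX c (current_density c (f n \<omega>)) x = 0" if "n < N" for n
    using s[OF that] by eventually_elim (use time_step in simp)
  ultimately show ?thesis by blast
qed

end
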